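(* In $\overrightarrow{\mathcal A(I)}$ the wheel diagrams are non-zero: for every even $m\ge2$ the class of a directed $m$-wheel diagram in $\overrightarrow{\mathcal A(I)}$ is non-zero.
   Context: A legally directed diagram based on an oriented interval $I$ is a connected graph containing $I$ as a distinguished subset, all of whose vertices are trivalent, with a cyclic order of the three edges at each vertex not on $I$, and with a direction (arrow) on each edge not contained in $I$, such that at each vertex not on $I$ exactly two edges are outgoing and one is ingoing. Vertices/edges not on $I$ are internal; vertices on $I$ are external. $\overrightarrow{\mathcal A(I)}$ is the complex vector space spanned by legally directed diagrams modulo: (1) Directed AS: reversing the cyclic order at one internal vertex changes the sign. (2) Directed STU: let $T$ and $U$ be diagrams which differ only in that two internal edges $e_1,e_2$ end at adjacent points of $I$, $e_1$ before $e_2$ in $T$ and $e_2$ before $e_1$ in $U$. If $e_1,e_2$ both point toward $I$, then $T-U=0$. Otherwise $T-U=S$, where in $S$ the two ends are joined at a new internal vertex $v$, connected by a new edge $e$ to $I$ at the same place, with cyclic order $(e_1,e_2,e)$ at $v$; $e_1,e_2$ keep their directions, and $e$ points from $I$ to $v$ if both $e_1,e_2$ point away from $I$, and from $v$ to $I$ if exactly one of them does. (3) Directed IHX (a consequence of (2)): the usual IHX relation with the four outer edges keeping their directions and the middle edge in each term directed in the unique legal way. The directed $m$-wheel: internal vertices $v_1,\dots,v_m$, cycle edges $v_iv_{i+1}$ (indices mod $m$) directed consistently around the cycle in one of the two ways, and for each $i$ a leg directed from $v_i$ to the $i$-th of $m$ consecutive points of $I$; the cyclic order at every $v_i$ is (leg,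 edge to $v_{i+1}$, edge to $v_{i-1}$). *)

theory Defs
  imports Complex_Main "HOL-Library.Poly_Mapping"
begin

section \<open>Legally directed diagrams\<close>

text \<open>
  A diagram is encoded by its half-edges, labelled by natural numbers, so that multiple edges and
  loops make sense. Every vertex on \<open>I\<close> carries exactly one half-edge not contained
  in \<open>I\<close>; \<open>legs\<close> lists these in the order given by the orientation of \<open>I\<close>, and the edges
  contained in \<open>I\<close> are implicit in this list. The half-edges at internal vertices
  form the set \<open>inner\<close>; \<open>nxt\<close> is the cyclic successor at the vertex, so that the internal vertices
  are the orbits of \<open>nxt\<close>. An edge not contained in \<open>I\<close>, directed from \<open>a\<close> to \<open>b\<close>, is
  the pair \<open>(a, b)\<close> of its tail half-edge and its head half-edge.
\<close>

record pre_diagram =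
  inner :: "nat set"
  legs :: "nat list"
  nxt :: "nat \<Rightarrow> nat"
  arrows :: "(nat \<times> nat) set"

definition half_edges :: "pre_diagram \<Rightarrow> nat set" where
  "half_edges D = inner D \<union> set (legs D)"

definition tails :: "pre_diagram \<Rightarrow> nat set" where
  "tails D = fst ` arrows D"

definition heads :: "pre_diagram \<Rightarrow> nat set" where
  "heads D = snd ` arrows D"

definition node :: "pre_diagram \<Rightarrow> nat \<Rightarrow> nat set" where
  "node D h = {h, nxt D h, nxt D (nxt D h)}"

definition trivalent :: "pre_diagram \<Rightarrow> bool" where
  "trivalent D \<longleftrightarrow>
     (\<forall>h\<in>inner D. nxt D h \<in> inner D \<and> nxt D h \<noteq> h \<and> nxt D (nxt D (nxt D h)) = h)"

definition edges_ok :: "pre_diagram \<Rightarrow> bool" where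
  "edges_ok D \<longleftrightarrow>
     arrows D \<subseteq> half_edges D \<times> half_edges D \<and>
     (\<forall>(a, b)\<in>arrows D. a \<noteq> b) \<and>
     (\<forall>h\<in>half_edges D. \<exists>!e. e \<in> arrows D \<and> (h = fst e \<or> h = snd e))"

text \<open>Exactly two edges leave and one edge enters each internal vertex; a loop counts for both.\<close>

definition legally_directed :: "pre_diagram \<Rightarrow> bool" where
  "legally_directed D \<longleftrightarrow>
     (\<forall>h\<in>inner D. card (node D h \<inter> tails D) = 2 \<and> card (node D h \<inter> heads D) = 1)"

text \<open>
  The graph contains the interval \<open>I\<close>, which is connected, so connectedness of the graph means that
  every internal vertex is joined by a path to some vertex on \<open>I\<close>.
\<close>

definition link :: "pre_diagram \<Rightarrow> (nat \<times> nat) set" where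
  "link D = {(h, nxt D h) | h. h \<in> inner D} \<union> arrows D \<union> (arrows D)\<inverse>"

definition connected_with_interval :: "pre_diagram \<Rightarrow> bool" where
  "connected_with_interval D \<longleftrightarrow> (\<forall>h\<in>inner D. \<exists>l\<in>set (legs D). (h, l) \<in> (link D)\<^sup>*)"

definition legal :: "pre_diagram \<Rightarrow> bool" where
  "legal D \<longleftrightarrow>
     finite (inner D) \<and> distinct (legs D) \<and> inner D \<inter> set (legs D) = {} \<and>
     trivalent D \<and> edges_ok D \<and> legally_directed D \<and> connected_with_interval D"

definition iso :: "pre_diagram \<Rightarrow> pre_diagram \<Rightarrow> bool" where
  "iso D E \<longleftrightarrow> (\<exists>f. bij_betw f (half_edges D) (half_edges E) \<and>
     f ` inner D = inner E \<and> map f (legs D) = legs E \<and>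
     (\<forall>h\<in>inner D. f (nxt D h) = nxt E (f h)) \<and>
     map_prod f f ` arrows D = arrows E)"

lemma legal_nxt: "legal D \<Longrightarrow> h \<in> inner D \<Longrightarrow> nxt D h \<in> inner D"
  by (auto simp: legal_def trivalent_def)

lemma iso_refl: "iso D D"
  unfolding iso_def by (rule exI[of _ id]) (auto simp: prod.map_id0)

lemma iso_sym:
  assumes "legal D" "iso D E"
  shows "iso E D"
proof -
  obtain f where bij: "bij_betw f (half_edges D) (half_edges E)"
    and inn: "f ` inner D = inner E" and lg: "map f (legs D) = legs E"
    and nx: "\<And>h. h \<in> inner D \<Longrightarrow> f (nxt D h) = nxt E (f h)"
    and ar: "map_prod f f ` arrows D = arrows E"
    using assms(2) by (auto simp: iso_def)
  define g where "g = inv_into (half_edges D) f"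
  have gf: "g (f h) = h" if "h \<in> half_edges D" for h
    using bij that by (simp add: g_def bij_betw_inv_into_left)
  have sub: "inner D \<subseteq> half_edges D" "set (legs D) \<subseteq> half_edges D"
    "arrows D \<subseteq> half_edges D \<times> half_edges D"
    using assms(1) by (auto simp: half_edges_def legal_def edges_ok_def)
  have "bij_betw g (half_edges E) (half_edges D)"
    unfolding g_def by (rule bij_betw_inv_into[OF bij])
  moreover have "g ` inner E = inner D"
    using gf sub(1) by (force simp: inn[symmetric] image_image)
  moreover have "map g (legs E) = legs D"
    using gf sub(2) by (auto simp: lg[symmetric] intro!: map_idI)
  moreover have "g (nxt E h) = nxt D (g h)" if h: "h \<in> inner E" for h
  proof -
    obtain k where k: "k \<in> inner D" "h = f k" using h inn by auto
    then show ?thesis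
      using nx[OF k(1)] gf sub(1) legal_nxt[OF assms(1) k(1)] by (metis subsetD)
  qed
  moreover have "map_prod g g ` arrows E = arrows D"
  proof -
    have "(map_prod g g \<circ> map_prod f f) ` arrows D = id ` arrows D"
      using gf sub(3) by (intro image_cong) auto
    then show ?thesis by (simp add: ar[symmetric] image_comp)
  qed
  ultimately show ?thesis unfolding iso_def by blast
qed

lemma iso_trans:
  assumes "iso D E" "iso E F"
  shows "iso D F"
proof -
  obtain f where f: "bij_betw f (half_edges D) (half_edges E)"
    "f ` inner D = inner E" "map f (legs D) = legs E"
    "\<And>h. h \<in> inner D \<Longrightarrow> f (nxt D h) = nxt E (f h)"
    "map_prod f f ` arrows D = arrows E"
    using assms(1) by (auto simp: iso_def)
  obtain g where g: "bij_betw g (half_edges E) (half_edges F)"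
    "g ` inner E = inner F" "map g (legs E) = legs F"
    "\<And>h. h \<in> inner E \<Longrightarrow> g (nxt E h) = nxt F (g h)"
    "map_prod g g ` arrows E = arrows F"
    using assms(2) by (auto simp: iso_def)
  have "map_prod (g \<circ> f) (g \<circ> f) ` arrows D = map_prod g g ` map_prod f f ` arrows D"
    by (simp only: image_image prod.map_comp)
  then have "map_prod (g \<circ> f) (g \<circ> f) ` arrows D = arrows F"
    using f(5) g(5) by simp
  moreover have "(g \<circ> f) ` inner D = inner F" using f(2) g(2) by (metis image_comp)
  moreover have "map (g \<circ> f) (legs D) = legs F" using f(3) g(3) by (metis map_map)
  moreover have "(g \<circ> f) (nxt D h) = nxt F ((g \<circ> f) h)" if "h \<in> inner D" for h
    using f(2,4) g(4) that by (metis comp_apply image_eqI)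
  ultimately show ?thesis
    unfolding iso_def using bij_betw_trans[OF f(1) g(1)] by blast
qed

lemma legal_empty: "legal \<lparr>inner = {}, legs = [], nxt = id, arrows = {}\<rparr>"
  by (simp add: legal_def trivalent_def edges_ok_def legally_directed_def half_edges_def
      connected_with_interval_def)

quotient_type diagram = pre_diagram / partial: "\<lambda>D E. legal D \<and> legal E \<and> iso D E"
proof (rule part_equivpI)
  show "\<exists>D. legal D \<and> legal D \<and> iso D D" using legal_empty iso_refl by blast
  show "symp (\<lambda>D E. legal D \<and> legal E \<and> iso D E)" by (auto intro!: sympI iso_sym)
  show "transp (\<lambda>D E. legal D \<and> legal E \<and> iso D E)" by (rule transpI) (meson iso_trans)
qed


section \<open>The relations\<close>

type_synonym free_space = "diagram \<Rightarrow>\<^sub>0 complex"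

definition scale_free :: "complex \<Rightarrow> free_space \<Rightarrow> free_space" where
  "scale_free c = Poly_Mapping.map ((*) c)"

lemma lookup_scale_free [simp]:
  "poly_mapping.lookup (scale_free c f) D = c * poly_mapping.lookup f D"
  by (simp add: scale_free_def Poly_Mapping.map.rep_eq when_def)

interpretation free: vector_space scale_free
  by unfold_locales (auto intro!: poly_mapping_eqI simp: lookup_add algebra_simps)

text \<open>The basis vector of a diagram; only meaningful for legal arguments.\<close>

definition diag :: "pre_diagram \<Rightarrow> free_space" where
  "diag D = Poly_Mapping.single (abs_diagram D) 1"

definition cyc :: "nat \<Rightarrow> nat \<Rightarrow> nat \<Rightarrow> (nat \<Rightarrow> nat) \<Rightarrow> nat \<Rightarrow> nat" where
  "cyc a b c f = f(a := b, b := c, c := a)"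

definition reverse_at :: "nat \<Rightarrow> pre_diagram \<Rightarrow> pre_diagram" where
  "reverse_at h D = D\<lparr>nxt := cyc h (nxt D (nxt D h)) (nxt D h) (nxt D)\<rparr>"

definition AS_relators :: "free_space set" where
  "AS_relators = {diag D + diag (reverse_at h D) | D h. legal D \<and> h \<in> inner D}"

text \<open>
  In the STU relation \<open>a\<close> and \<open>b\<close> are the half-edges at the two adjacent points of \<open>I\<close>. In \<open>S\<close> they
  are moved, with their edges and directions, to a new internal vertex, whose third
  half-edge \<open>c\<close> is joined to a new half-edge \<open>l\<close> on \<open>I\<close>. The relation is local: \<open>a\<close> and \<open>b\<close> may be
  the two ends of the same edge.
\<close>

definition stu_S :: "pre_diagram \<Rightarrow> nat list \<Rightarrow> nat \<Rightarrow> nat \<Rightarrow> nat list \<Rightarrow> nat \<Rightarrow> nat \<Rightarrow> pre_diagram" where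
  "stu_S T xs a b ys c l =
     \<lparr>inner = inner T \<union> {a, b, c},
      legs = xs @ l # ys,
      nxt = cyc a b c (nxt T),
      arrows = insert (if a \<in> tails T \<and> b \<in> tails T then (l, c) else (c, l)) (arrows T)\<rparr>"

definition STU_relators :: "free_space set" where
  "STU_relators =
     {diag T - diag (T\<lparr>legs := xs @ b # a # ys\<rparr>) | T xs a b ys.
        legal T \<and> legs T = xs @ a # b # ys \<and> a \<in> heads T \<and> b \<in> heads T} \<union>
     {diag T - diag (T\<lparr>legs := xs @ b # a # ys\<rparr>) - diag (stu_S T xs a b ys c l) | T xs a b ys c l.
        legal T \<and> legs T = xs @ a # b # ys \<and> \<not> (a \<in> heads T \<and> b \<in> heads T) \<and>
        c \<notin> half_edges T \<and> l \<notin> half_edges T \<and> c \<noteq> l}"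

text \<open>
  The IHX relation \<open>I = H - X\<close>. In the planar picture of \<open>I\<close> the middle edge is vertical and goes down
  from \<open>p\<close> to \<open>q\<close>, and counterclockwise the upper vertex is \<open>(p, ne, nw)\<close> and the lower
  vertex is \<open>(q, sw, se)\<close>. In \<open>H\<close> and \<open>X\<close> the middle edge is horizontal with \<open>p\<close> at the left end and
  \<open>q\<close> at the right end, directed either way as required by legality. \<open>X\<close> arises from \<open>H\<close> by exchanging the
  two upper outer edges. The reflected situation, where the arrow of \<open>I\<close> points upwards, is the same
  picture rotated by a half turn, up to reversing both vertices of \<open>X\<close>.
\<close>

definition rewire :: "pre_diagram \<Rightarrow> nat \<Rightarrow> nat \<Rightarrow> (nat \<Rightarrow> nat) \<Rightarrow> pre_diagram set" where
  "rewire D p q f = {E. legal E \<and>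
     (\<exists>e\<in>{(p, q), (q, p)}. E = D\<lparr>nxt := f, arrows := insert e (arrows D - {(p, q)})\<rparr>)}"

definition IHX_relators :: "free_space set" where
  "IHX_relators = {diag D - diag H + diag X | D H X p q ne nw sw se.
     legal D \<and> p \<in> inner D \<and> q \<in> inner D \<and> (p, q) \<in> arrows D \<and> q \<notin> node D p \<and>
     ne = nxt D p \<and> nw = nxt D ne \<and> sw = nxt D q \<and> se = nxt D sw \<and>
     H \<in> rewire D p q (cyc p nw sw (cyc q se ne (nxt D))) \<and>
     X \<in> rewire D p q (cyc p ne sw (cyc q se nw (nxt D)))}"

definition relations :: "free_space set" where
  "relations = free.span (AS_relators \<union> STU_relators \<union> IHX_relators)"


section \<open>The space of diagrams modulo the relations\<close>

lemma subspace_relations: "free.subspace relations"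
  by (simp add: relations_def free.subspace_span)

lemmas relations_zero = free.subspace_0[OF subspace_relations]
  and relations_add = free.subspace_add[OF subspace_relations]
  and relations_diff = free.subspace_diff[OF subspace_relations]
  and relations_neg = free.subspace_neg[OF subspace_relations]
  and relations_scale = free.subspace_scale[OF subspace_relations]

quotient_type arrow_space = free_space / "\<lambda>f g. f - g \<in> relations"
proof (rule equivpI)
  show "reflp (\<lambda>f g. f - g \<in> relations)"
    by (simp add: reflp_def relations_zero)
  show "symp (\<lambda>f g. f - g \<in> relations)"
    by (rule sympI) (drule relations_neg, simp)
  show "transp (\<lambda>f g. f - g \<in> relations)"
    by (rule transpI) (drule (1) relations_add, simp)
qed

instantiation arrow_space :: ab_group_add
begin

lift_definition zero_arrow_space :: arrow_space is 0 .

lift_definition plus_arrow_space :: "arrow_space \<Rightarrow> arrow_space \<Rightarrow> arrow_space" is "(+)"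
  by (drule (1) relations_add) (simp add: algebra_simps)

lift_definition uminus_arrow_space :: "arrow_space \<Rightarrow> arrow_space" is uminus
  by (drule relations_neg) simp

lift_definition minus_arrow_space :: "arrow_space \<Rightarrow> arrow_space \<Rightarrow> arrow_space" is "(-)"
  by (drule (1) relations_diff) (simp add: algebra_simps)

instance
  by standard (transfer, simp add: relations_zero algebra_simps)+

end

lift_definition scale_arrow_space :: "complex \<Rightarrow> arrow_space \<Rightarrow> arrow_space" is scale_free
  by (drule relations_scale) (simp add: free.scale_right_diff_distrib)

interpretation arrow_space: vector_space scale_arrow_space
  by unfold_locales
    (transfer, simp add: relations_zero free.scale_right_distrib free.scale_left_distrib)+

definition diagram_class :: "diagram \<Rightarrow> arrow_space" where
  "diagram_class D = abs_arrow_space (Poly_Mapping.single D 1)"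


section \<open>The directed wheels\<close>

text \<open>
  The internal vertex \<open>v\<^sub>i\<close>, for \<open>i < m\<close>, has the half-edges \<open>4 * i\<close> (leg), \<open>4 * i + 1\<close> (towards the next
  vertex of the cycle) and \<open>4 * i + 2\<close> (towards the previous one), in this cyclic order; the other end
  of its leg is \<open>4 * i + 3\<close>. The flag chooses between the two directions of the cycle.
\<close>

definition pre_wheel :: "bool \<Rightarrow> nat \<Rightarrow> pre_diagram" where
  "pre_wheel fwd m =
     \<lparr>inner = {4 * i + j | i j. i < m \<and> j < 3},
      legs = map (\<lambda>i. 4 * i + 3) [0..<m],
      nxt = (\<lambda>h. if h mod 4 = 2 then h - 2 else h + 1),
      arrows = {(4 * i, 4 * i + 3) | i. i < m} \<union>
        (let cycle = {(4 * i + 1, 4 * (Suc i mod m) + 2) | i. i < m}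
         in if fwd then cycle else cycle\<inverse>)\<rparr>"

lemma inner_wheel: "inner (pre_wheel fwd m) = {4 * i + j | i j. i < m \<and> j < 3}"
  and legs_wheel: "legs (pre_wheel fwd m) = map (\<lambda>i. 4 * i + 3) [0..<m]"
  and nxt_wheel: "nxt (pre_wheel fwd m) h = (if h mod 4 = 2 then h - 2 else h + 1)"
  by (simp_all add: pre_wheel_def)

lemma arrows_wheel: "(a, b) \<in> arrows (pre_wheel fwd m) \<longleftrightarrow>
    (\<exists>i<m. a = 4 * i \<and> b = 4 * i + 3) \<or>
    (\<exists>i<m. (if fwd then (a, b) else (b, a)) = (4 * i + 1, 4 * (Suc i mod m) + 2))"
  by (auto simp: pre_wheel_def Let_def)

lemma pred_mod:
  fixes i m :: nat
  assumes "i < m"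
  shows "\<exists>!k. k < m \<and> Suc k mod m = i"
proof (cases i)
  case 0
  then show ?thesis using assms
    by (intro ex1I[of _ "m - 1"]) (auto simp: mod_Suc split: if_splits)
next
  case (Suc j)
  then show ?thesis using assms
    by (intro ex1I[of _ j]) (auto simp: mod_Suc split: if_splits)
qed

lemma legal_wheel: "legal (pre_wheel fwd m)"
proof -
  let ?D = "pre_wheel fwd m"
  have inn: "h \<in> inner ?D \<longleftrightarrow> (\<exists>i<m. h = 4 * i \<or> h = 4 * i + 1 \<or> h = 4 * i + 2)" for h
  proof
    assume "h \<in> inner ?D"
    then obtain i j where ij: "i < m" "j < 3" "h = 4 * i + j" by (auto simp: inner_wheel)
    then have "j = 0 \<or> j = 1 \<or> j = 2" by linarith
    with ij show "\<exists>i<m. h = 4 * i \<or> h = 4 * i + 1 \<or> h = 4 * i + 2" by auto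
  next
    assume "\<exists>i<m. h = 4 * i \<or> h = 4 * i + 1 \<or> h = 4 * i + 2"
    then obtain i where i: "i < m" "h = 4 * i + 0 \<or> h = 4 * i + 1 \<or> h = 4 * i + 2" by auto
    then obtain j where "j < 3" "h = 4 * i + j" by force
    with i show "h \<in> inner ?D" by (auto simp: inner_wheel)
  qed
  have lg: "h \<in> set (legs ?D) \<longleftrightarrow> (\<exists>i<m. h = 4 * i + 3)" for h
    by (auto simp: legs_wheel)
  have he: "h \<in> half_edges ?D \<longleftrightarrow>
      (\<exists>i<m. h = 4 * i \<or> h = 4 * i + 1 \<or> h = 4 * i + 2 \<or> h = 4 * i + 3)" for h
    unfolding half_edges_def Un_iff inn lg by blast
  have nx: "nxt ?D (4 * i) = 4 * i + 1" "nxt ?D (4 * i + 1) = 4 * i + 2"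
    "nxt ?D (4 * i + 2) = 4 * i" for i
    by (simp_all add: nxt_wheel) presburger+
  have fin: "finite (inner ?D)"
    by (rule finite_subset[of _ "{..<4 * m}"]) (auto simp: inn)
  have dist: "distinct (legs ?D)"
    by (auto simp: legs_wheel distinct_map inj_on_def)
  have disj: "inner ?D \<inter> set (legs ?D) = {}"
  proof -
    have "4 * i \<noteq> 4 * k + 3" "4 * i + 1 \<noteq> 4 * k + 3" "4 * i + 2 \<noteq> 4 * k + 3" for i k :: nat
      by presburger+
    then show ?thesis unfolding disjoint_iff inn lg by metis
  qed
  have triv: "trivalent ?D"
    unfolding trivalent_def
  proof
    fix h assume "h \<in> inner ?D"
    then obtain i where i: "i < m" "h = 4 * i \<or> h = 4 * i + 1 \<or> h = 4 * i + 2" by (auto simp: inn)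
    then show "nxt ?D h \<in> inner ?D \<and> nxt ?D h \<noteq> h \<and> nxt ?D (nxt ?D (nxt ?D h)) = h"
      using nx[of i] by (auto simp: inn)
  qed
  have tl: "h \<in> tails ?D \<longleftrightarrow> (\<exists>i<m. h = 4 * i \<or> h = 4 * i + (if fwd then 1 else 2))"
    and hd: "h \<in> heads ?D \<longleftrightarrow> (\<exists>i<m. h = 4 * i + 3 \<or> h = 4 * i + (if fwd then 2 else 1))" for h
  proof -
    have sur: "(\<exists>i<m. h = 4 * (Suc i mod m) + 2) \<longleftrightarrow> (\<exists>i<m. h = 4 * i + 2)"
    proof
      assume "\<exists>i<m. h = 4 * (Suc i mod m) + 2"
      then obtain i where "i < m" "h = 4 * (Suc i mod m) + 2" by blast
      then show "\<exists>i<m. h = 4 * i + 2" by (intro exI[of _ "Suc i mod m"]) simp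
    next
      assume "\<exists>i<m. h = 4 * i + 2"
      then show "\<exists>i<m. h = 4 * (Suc i mod m) + 2" by (metis pred_mod)
    qed
    have t: "h \<in> tails ?D \<longleftrightarrow> (\<exists>b. (h, b) \<in> arrows ?D)" "h \<in> heads ?D \<longleftrightarrow> (\<exists>a. (a, h) \<in> arrows ?D)"
      by (force simp: tails_def heads_def)+
    have a: "(\<exists>b. (h, b) \<in> arrows ?D) \<longleftrightarrow> (\<exists>i<m. h = 4 * i) \<or>
        (if fwd then \<exists>i<m. h = 4 * i + 1 else \<exists>i<m. h = 4 * (Suc i mod m) + 2)"
      "(\<exists>a. (a, h) \<in> arrows ?D) \<longleftrightarrow> (\<exists>i<m. h = 4 * i + 3) \<or>
        (if fwd then \<exists>i<m. h = 4 * (Suc i mod m) + 2 else \<exists>i<m. h = 4 * i + 1)"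
      unfolding arrows_wheel
      by (cases fwd; simp only: if_True if_False prod.inject simp_thms; blast)+
    show "h \<in> tails ?D \<longleftrightarrow> (\<exists>i<m. h = 4 * i \<or> h = 4 * i + (if fwd then 1 else 2))"
      "h \<in> heads ?D \<longleftrightarrow> (\<exists>i<m. h = 4 * i + 3 \<or> h = 4 * i + (if fwd then 2 else 1))"
      unfolding t a sur by (cases fwd; simp only: if_True if_False; blast)+
  qed
  have edges: "edges_ok ?D"
    unfolding edges_ok_def
  proof (intro conjI ballI)
    show "arrows ?D \<subseteq> half_edges ?D \<times> half_edges ?D"
    proof (rule subrelI)
      fix a b assume "(a, b) \<in> arrows ?D"
      then show "(a, b) \<in> half_edges ?D \<times> half_edges ?D"
        unfolding arrows_wheel mem_Sigma_iff he
        by (auto split: if_splits intro: mod_less_divisor)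
          (metis gr_implies_not0 mod_less_divisor neq0_conv)+
    qed
  next
    fix e assume "e \<in> arrows ?D"
    moreover have "4 * i + 1 \<noteq> 4 * k + 2" for i k :: nat by presburger
    ultimately show "case e of (a, b) \<Rightarrow> a \<noteq> b"
      by (cases e) (auto simp: arrows_wheel split: if_splits)
  next
    fix h assume "h \<in> half_edges ?D"
    then obtain i where i: "i < m"
      and h: "h = 4 * i \<or> h = 4 * i + 1 \<or> h = 4 * i + 2 \<or> h = 4 * i + 3"
      unfolding he by blast
    have ne: "4 * j \<noteq> 4 * k + 1" "4 * j \<noteq> 4 * k + 2" "4 * j \<noteq> 4 * k + 3"
      "4 * j + 1 \<noteq> 4 * k + 2" "4 * j + 1 \<noteq> 4 * k + 3" "4 * j + 2 \<noteq> 4 * k + 3"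
      "Suc (4 * j) \<noteq> 4 * k + 3" "Suc (Suc (4 * j)) \<noteq> 4 * k + 3" for j k :: nat
      by presburger+
    note ne' = ne ne[symmetric]
    obtain k where k: "k < m" "Suc k mod m = i" "\<And>k'. k' < m \<Longrightarrow> Suc k' mod m = i \<Longrightarrow> k' = k"
      using pred_mod[OF i] by blast
    define dir where "dir = (\<lambda>x y :: nat. if fwd then (x, y) else (y, x))"
    have arr: "arrows ?D = {(4 * i, 4 * i + 3) | i. i < m} \<union>
        {dir (4 * i + 1) (4 * (Suc i mod m) + 2) | i. i < m}"
      by (rule set_eqI, case_tac x, simp only: arrows_wheel, cases fwd) (auto simp: dir_def)
    from h show "\<exists>!e. e \<in> arrows ?D \<and> (h = fst e \<or> h = snd e)"
    proof (elim disjE)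
      assume "h = 4 * i" then show ?thesis
        using i ne' by (intro ex1I[of _ "(4 * i, 4 * i + 3)"]) (auto simp: arr dir_def split: if_splits)
    next
      assume "h = 4 * i + 3" then show ?thesis
        using i ne' by (intro ex1I[of _ "(4 * i, 4 * i + 3)"]) (auto simp: arr dir_def split: if_splits)
    next
      assume "h = 4 * i + 1" then show ?thesis
        using i ne' by (intro ex1I[of _ "dir (4 * i + 1) (4 * (Suc i mod m) + 2)"])
          (auto simp: arr dir_def split: if_splits)
    next
      assume "h = 4 * i + 2" then show ?thesis
        using i k(1,2) ne' by (intro ex1I[of _ "dir (4 * k + 1) (4 * i + 2)"])
          (auto simp: arr dir_def split: if_splits dest: k(3) k(3)[OF _ sym])
    qed
  qed
  have dir: "legally_directed ?D"
    unfolding legally_directed_def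
  proof
    fix h assume "h \<in> inner ?D"
    then obtain i where i: "i < m" "h = 4 * i \<or> h = 4 * i + 1 \<or> h = 4 * i + 2" by (auto simp: inn)
    then have "node ?D h = {4 * i, 4 * i + 1, 4 * i + 2}"
      using nx[of i] by (auto simp: node_def)
    moreover have "4 * i \<in> tails ?D" "4 * i + 1 \<in> tails ?D \<longleftrightarrow> fwd"
      "4 * i + 2 \<in> tails ?D \<longleftrightarrow> \<not> fwd" "4 * i \<notin> heads ?D"
      "4 * i + 1 \<in> heads ?D \<longleftrightarrow> \<not> fwd" "4 * i + 2 \<in> heads ?D \<longleftrightarrow> fwd"
      unfolding tl hd using i(1) by (auto; presburger)+
    ultimately show "card (node ?D h \<inter> tails ?D) = 2 \<and> card (node ?D h \<inter> heads ?D) = 1"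
      by (cases fwd) (simp_all add: Int_insert_left)
  qed
  have conn: "connected_with_interval ?D"
    unfolding connected_with_interval_def
  proof
    fix h assume "h \<in> inner ?D"
    then obtain i where i: "i < m" "h = 4 * i \<or> h = 4 * i + 1 \<or> h = 4 * i + 2" by (auto simp: inn)
    have "(4 * i, 4 * i + 3) \<in> link ?D"
      using i(1) by (auto simp: link_def arrows_wheel)
    moreover have "(4 * i + 1, 4 * i + 2) \<in> link ?D" "(4 * i + 2, 4 * i) \<in> link ?D"
      using i(1) nx[of i] by (force simp: link_def inn)+
    ultimately have "(h, 4 * i + 3) \<in> (link ?D)\<^sup>*"
      using i(2) by (meson r_into_rtrancl rtrancl_trans)
    then show "\<exists>l\<in>set (legs ?D). (h, l) \<in> (link ?D)\<^sup>*"
      using i(1) lg by blast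
  qed
  show ?thesis
    unfolding legal_def using fin dist disj triv edges dir conn by blast
qed

lift_definition wheel :: "bool \<Rightarrow> nat \<Rightarrow> diagram" is pre_wheel
  by (simp add: legal_wheel iso_refl)

end

theory Submission
  imports Defs "HOL-Library.FuncSet"
begin

text \<open>
  A linear functional that kills all relations but not the wheel is a \<^emph>\<open>weight system\<close>, obtained
  from a Lie algebra. Let \<open>g\<close> be the two-dimensional Lie algebra with basis \<open>X\<close>, \<open>Y\<close> and bracket
  \<open>[X, Y] = Y\<close>, and let \<open>L = g \<oplus> g\<^sup>*\<close> be the semidirect product of \<open>g\<close> with its dual, an abelian ideal
  on which \<open>g\<close> acts by the coadjoint action. With the dual basis \<open>X'\<close>, \<open>Y'\<close> the brackets are
  \<open>[X, Y] = Y\<close>, \<open>[X, Y'] = - Y'\<close> and \<open>[Y, Y'] = X'\<close>, and \<open>X'\<close> is central. Evaluating functionals on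
  vectors gives an invariant symmetric form on \<open>L\<close>, so that \<open>\<langle>[u, v], w\<rangle>\<close> is an alternating form;
  on basis vectors it is non-zero only if \<open>u\<close>, \<open>v\<close>, \<open>w\<close> are \<open>X\<close>, \<open>Y\<close>, \<open>Y'\<close> in some order.
  
  Label the half-edges of a diagram by basis vectors so that every arrow carries \<open>X\<close> at its tail and
  \<open>X'\<close> at its head, or \<open>Y\<close> and \<open>Y'\<close>. Tails thus carry vectors of \<open>g\<close> and heads vectors of \<open>g\<^sup>*\<close>.
  Multiply the values of the alternating form at the internal vertices with the value, under a fixed
  linear functional on the universal enveloping algebra of \<open>L\<close>, of the word read along the interval;
  the weight is the sum over all labellings. Reversing a vertex changes the sign because the form
  is alternating, the STU relation expresses \<open>u v - v u = [u, v]\<close> in the enveloping algebra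
  (two heads commute because \<open>g\<^sup>*\<close> is abelian), and the IHX relation is the Jacobi identity. The
  vertex directions, two out and one in, match the fact that the form needs two vectors of \<open>g\<close> and
  one of \<open>g\<^sup>*\<close>; this is why summing over one direction of an arrow gives the same as
  contracting with the full invariant form.
  
  On a wheel, every vertex is entered by an arrow of the cycle, whose head has to carry \<open>Y'\<close>.
  So all arrows of the cycle carry \<open>Y\<close> and \<open>Y'\<close>, all legs carry \<open>X\<close> and \<open>X'\<close>, and only one labelling
  contributes, with the value of the word \<open>X' \<dots> X'\<close> up to sign. It remains to choose the functional so that
  the powers of \<open>X'\<close> do not vanish: the oscillator representation, in which the central element \<open>X'\<close> acts
  as the identity, provides it.
\<close>

section \<open>The Lie algebra and a functional on its enveloping algebra\<close>

datatype letter = X | Y | X' | Y'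

lemma UNIV_letter: "UNIV = {X, Y, X', Y'}"
  using letter.exhaust by blast

instance letter :: finite
  by standard (simp add: UNIV_letter)

lemma sum_letter: "(\<Sum>u\<in>UNIV. f u) = f X + f Y + f X' + f Y'"
  by (simp add: UNIV_letter add.assoc)

definition is_tail :: "letter \<Rightarrow> bool" where
  "is_tail u \<longleftrightarrow> u = X \<or> u = Y"

definition joined :: "letter \<Rightarrow> letter \<Rightarrow> complex" where
  "joined u v = of_bool (u = X \<and> v = X' \<or> u = Y \<and> v = Y')"

text \<open>
  The invariant form of \<open>L\<close> on basis vectors.
\<close>

definition paired :: "letter \<Rightarrow> letter \<Rightarrow> complex" where
  "paired u v = joined u v + joined v u"

text \<open>
  The alternating form \<open>\<langle>[u, v], w\<rangle>\<close>.
\<close>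

definition bracket3 :: "letter \<Rightarrow> letter \<Rightarrow> letter \<Rightarrow> complex" where
  "bracket3 u v w =
     of_bool ((u, v, w) \<in> {(X, Y, Y'), (Y, Y', X), (Y', X, Y)}) -
     of_bool ((u, v, w) \<in> {(Y, X, Y'), (X, Y', Y), (Y', Y, X)})"

text \<open>
  In the oscillator representation on polynomials in \<open>t\<close>, the letters act as \<open>Y = d/dt\<close>,
  \<open>Y' = t\<close>, \<open>X = - t d/dt\<close> and \<open>X' = 1\<close>. The value of a word at \<open>n\<close> is the sum of the coefficients
  of \<open>t ^ n\<close> in its images of the monomials. The recursion reads the word from the left, that is, it lets the letters act on the
  functional taking the coefficient of \<open>t ^ n\<close>; each letter maps such a functional to a multiple of another one.
\<close>

fun word_value :: "letter list \<Rightarrow> nat \<Rightarrow> complex" where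
  "word_value [] n = 1"
| "word_value (X # w) n = - of_nat n * word_value w n"
| "word_value (Y # w) n = of_nat (n + 1) * word_value w (n + 1)"
| "word_value (X' # w) n = word_value w n"
| "word_value (Y' # w) n = (if n = 0 then 0 else word_value w (n - 1))"

lemma bracket3_rotate: "bracket3 v w u = bracket3 u v w"
  by (cases u; cases v; cases w; simp add: bracket3_def)

lemma bracket3_swap: "bracket3 u w v = - bracket3 u v w"
  by (cases u; cases v; cases w; simp add: bracket3_def)

text \<open>
  Since the values are \<open>0\<close>, \<open>1\<close> and \<open>-1\<close>, a product over half-edges, in which every internal vertex occurs
  three times, equals the product over vertices, and no representatives of the vertices are needed.
\<close>

lemma bracket3_cube: "bracket3 u v w * (bracket3 u v w * bracket3 u v w) = bracket3 u v w"
  by (cases u; cases v; cases w; simp add: bracket3_def)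

lemma joined_is_tail: "joined u v \<noteq> 0 \<Longrightarrow> is_tail u \<and> \<not> is_tail v"
  by (auto simp: joined_def is_tail_def split: if_splits)

text \<open>
  The counterpart in \<open>L\<close> of a legal vertex, which has two outgoing edges.
\<close>

lemma bracket3_is_tail: "bracket3 u v w \<noteq> 0 \<Longrightarrow> 
    of_bool (is_tail u) + of_bool (is_tail v) + of_bool (is_tail w) = (2::nat)"
  by (cases u; cases v; cases w; simp add: bracket3_def is_tail_def)

text \<open>
  The sums contract two trivalent vertices along an edge, so this is the Jacobi identity of \<open>L\<close> paired
  with a fourth vector.
\<close>

lemma jacobi:
  "(\<Sum>u\<in>UNIV. \<Sum>v\<in>UNIV. paired u v * (bracket3 u a b * bracket3 v c d)) -
   (\<Sum>u\<in>UNIV. \<Sum>v\<in>UNIV. paired u v * (bracket3 u b c * bracket3 v d a)) +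
   (\<Sum>u\<in>UNIV. \<Sum>v\<in>UNIV. paired u v * (bracket3 u a c * bracket3 v d b)) = 0"
  by (cases a; cases b; cases c; cases d; simp add: sum_letter bracket3_def paired_def joined_def)

text \<open>
  The right-hand side is the value of the word with the two letters replaced by their bracket, since
  \<open>[a, b]\<close> is the sum of \<open>\<langle>[a, b], u\<rangle> v\<close> over the dual pairs \<open>(u, v)\<close>.
\<close>

lemma word_value_commutator:
  "word_value (xs @ a # b # ys) n - word_value (xs @ b # a # ys) n =
   (\<Sum>u\<in>UNIV. \<Sum>v\<in>UNIV. paired u v * (bracket3 a b u * word_value (xs @ v # ys) n))"
proof (induction xs arbitrary: n)
  case Nil
  show ?case
    by (cases a; cases b; cases n;
        simp add: sum_letter bracket3_def paired_def joined_def algebra_simps)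
next
  case (Cons x xs)
  \<comment> \<open>a common prefix only rescales the values and shifts \<open>n\<close>\<close>
  obtain c k where "word_value (x # w) n = c * word_value w k" for w
  proof (cases x)
    case X
    then show ?thesis using that[of "- of_nat n" n] by simp
  next
    case Y
    then show ?thesis using that[of "of_nat (n + 1)" "n + 1"] by simp
  next
    case X'
    then show ?thesis using that[of 1 n] by simp
  next
    case Y'
    then show ?thesis using that[of "of_bool (n \<noteq> 0)" "n - 1"] by simp
  qed
  then show ?case
    by (simp add: right_diff_distrib[symmetric] Cons.IH sum_distrib_left mult.left_commute del: word_value.simps)
qed

section \<open>Labellings and weights\<close>

lemma sum_PiE_insert:
  fixes F :: "('a \<Rightarrow> 'b) \<Rightarrow> 'c :: comm_monoid_add"
  assumes "x \<notin> A"
  shows "(\<Sum>g\<in>insert x A \<rightarrow>\<^sub>E B. F g) = (\<Sum>g\<in>A \<rightarrow>\<^sub>E B. \<Sum>u\<in>B. F (g(x := u)))"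
proof -
  have "(\<Sum>g\<in>insert x A \<rightarrow>\<^sub>E B. F g) = (\<Sum>(u, g)\<in>B \<times> (A \<rightarrow>\<^sub>E B). F (g(x := u)))"
    unfolding PiE_insert_eq
    by (subst sum.reindex[OF inj_combinator[OF assms]]) (simp add: case_prod_unfold)
  also have "\<dots> = (\<Sum>u\<in>B. \<Sum>g\<in>A \<rightarrow>\<^sub>E B. F (g(x := u)))"
    by (simp add: sum.cartesian_product)
  finally show ?thesis by (simp add: sum.swap[of _ B])
qed

definition vertex_factor :: "pre_diagram \<Rightarrow> (nat \<Rightarrow> letter) \<Rightarrow> nat \<Rightarrow> complex" where
  "vertex_factor D s h = bracket3 (s h) (s (nxt D h)) (s (nxt D (nxt D h)))"

definition arrow_factor :: "(nat \<Rightarrow> letter) \<Rightarrow> nat \<times> nat \<Rightarrow> complex" where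
  "arrow_factor s e = joined (s (fst e)) (s (snd e))"

definition amplitude :: "pre_diagram \<Rightarrow> (nat \<Rightarrow> letter) \<Rightarrow> complex" where
  "amplitude D s = (\<Prod>e\<in>arrows D. arrow_factor s e) * (\<Prod>h\<in>inner D. vertex_factor D s h) *
     word_value (map s (legs D)) 0"

definition weight :: "pre_diagram \<Rightarrow> complex" where
  "weight D = (\<Sum>s\<in>half_edges D \<rightarrow>\<^sub>E UNIV. amplitude D s)"

section \<open>Half-edges of legal diagrams\<close>

lemma legalD:
  assumes "legal D"
  shows "finite (inner D)" "finite (half_edges D)" "finite (arrows D)"
    "arrows D \<subseteq> half_edges D \<times> half_edges D"
proof -
  show i: "finite (inner D)" and h: "finite (half_edges D)"
    using assms by (auto simp: legal_def half_edges_def)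
  show a: "arrows D \<subseteq> half_edges D \<times> half_edges D"
    using assms by (auto simp: legal_def edges_ok_def)
  show "finite (arrows D)" using a h finite_subset by blast
qed

lemma legal_nodeD:
  assumes "legal D" "h \<in> inner D"
  shows "nxt D h \<in> inner D" "nxt D (nxt D h) \<in> inner D" "nxt D (nxt D (nxt D h)) = h"
    "nxt D h \<noteq> h" "nxt D (nxt D h) \<noteq> h" "nxt D (nxt D h) \<noteq> nxt D h"
    "node D h \<subseteq> inner D"
proof -
  have t: "nxt D k \<in> inner D \<and> nxt D k \<noteq> k \<and> nxt D (nxt D (nxt D k)) = k" if "k \<in> inner D" for k
    using assms(1) that by (simp add: legal_def trivalent_def)
  note h = t[OF assms(2)] and h' = t[OF conjunct1[OF t[OF assms(2)]]]
  show "nxt D h \<in> inner D" "nxt D (nxt D h) \<in> inner D" "nxt D (nxt D (nxt D h)) = h"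
    "nxt D h \<noteq> h" "nxt D (nxt D h) \<noteq> nxt D h"
    using h h' by blast+
  show "nxt D (nxt D h) \<noteq> h" using h by metis
  show "node D h \<subseteq> inner D" using assms(2) h h' by (simp add: node_def)
qed

lemma nxt_outside_node:
  assumes "legal D" "h \<in> inner D" "k \<in> inner D - node D h"
  shows "nxt D k \<in> inner D - node D h"
proof -
  have k: "k \<in> inner D" "k \<notin> node D h" using assms(3) by auto
  have "nxt D x \<in> node D h" if "x \<in> node D h" for x
    using that legal_nodeD(3)[OF assms(1,2)] by (auto simp: node_def)
  then have "nxt D k \<in> node D h \<Longrightarrow> nxt D (nxt D (nxt D k)) \<in> node D h" by blast
  then have "nxt D k \<notin> node D h" using k(2) legal_nodeD(3)[OF assms(1) k(1)] by auto
  then show ?thesis using legal_nodeD(1)[OF assms(1) k(1)] by simp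
qed

text \<open>
  Splits off the vertex of \<open>h\<close>. Its three half-edges have equal factors by the cyclic symmetry of the form, and
  the cube of such a factor is the factor itself.
\<close>

lemma prod_vertex_factor:
  assumes "legal D" "h \<in> inner D" "node D h \<subseteq> A" "finite A"
  shows "(\<Prod>k\<in>A. vertex_factor D s k) =
    vertex_factor D s h * (\<Prod>k\<in>A - node D h. vertex_factor D s k)"
proof -
  note n = legal_nodeD[OF assms(1,2)]
  have "(\<Prod>k\<in>node D h. vertex_factor D s k) = vertex_factor D s h"
    using n bracket3_cube by (simp add: node_def vertex_factor_def bracket3_rotate)
  then show ?thesis
    using prod.subset_diff[OF assms(3,4), of "vertex_factor D s"] by (simp add: mult.commute)
qed

lemma half_edge_arrow:
  assumes "legal D" "h \<in> half_edges D"
  shows "\<exists>!e. e \<in> arrows D \<and> (h = fst e \<or> h = snd e)"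
  using assms by (auto simp: legal_def edges_ok_def)

lemma snd_not_tail:
  assumes "legal D" "(a, b) \<in> arrows D"
  shows "b \<notin> tails D"
proof
  assume "b \<in> tails D"
  then obtain c where c: "(b, c) \<in> arrows D" by (auto simp: tails_def)
  have "b \<in> half_edges D" "a \<noteq> b"
    using assms by (auto simp: legal_def edges_ok_def)
  then have "(a, b) = (b, c)"
    using half_edge_arrow[OF assms(1)] assms(2) c by (metis fst_conv snd_conv)
  then show False using \<open>a \<noteq> b\<close> by simp
qed

lemma heads_iff:
  assumes "legal D" "h \<in> half_edges D"
  shows "h \<in> heads D \<longleftrightarrow> h \<notin> tails D"
proof
  assume "h \<in> heads D"
  then show "h \<notin> tails D" using snd_not_tail[OF assms(1)] by (auto simp: heads_def)
next
  assume "h \<notin> tails D"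
  moreover obtain e where "e \<in> arrows D" "h = fst e \<or> h = snd e"
    using half_edge_arrow[OF assms] by blast
  ultimately show "h \<in> heads D" unfolding heads_def tails_def by blast
qed

text \<open>
  In a contributing labelling the arrows force vectors of \<open>g\<close> on tails and of \<open>g\<^sup>*\<close> on heads. One
  arrow \<open>e0\<close> is exempted because its ends will be summed over separately.
\<close>

lemma is_tail_iff:
  assumes "legal D" "h \<in> half_edges D" "h \<noteq> fst e0" "h \<noteq> snd e0"
    "(\<Prod>e\<in>arrows D - {e0}. arrow_factor s e) \<noteq> 0"
  shows "is_tail (s h) \<longleftrightarrow> h \<in> tails D"
proof -
  obtain e where e: "e \<in> arrows D" "h = fst e \<or> h = snd e"
    using half_edge_arrow[OF assms(1,2)] by blast
  then have "arrow_factor s e \<noteq> 0"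
    using assms(3-5) legalD(3)[OF assms(1)] by (auto simp: prod_zero_iff)
  then have "is_tail (s (fst e))" "\<not> is_tail (s (snd e))"
    using joined_is_tail by (auto simp: arrow_factor_def)
  moreover have "fst e \<in> tails D" using e by (auto simp: tails_def)
  moreover have "snd e \<notin> tails D" using snd_not_tail[OF assms(1)] e by (cases e) auto
  ultimately show ?thesis using e(2) by auto
qed

lemma card_node_tails:
  assumes "legal D" "h \<in> inner D"
  shows "of_bool (h \<in> tails D) + of_bool (nxt D h \<in> tails D) + of_bool (nxt D (nxt D h) \<in> tails D)
    = (2::nat)"
proof -
  have "card (node D h \<inter> tails D) = 2"
    using assms by (auto simp: legal_def legally_directed_def)
  moreover have "card (node D h \<inter> tails D) =
      of_bool (h \<in> tails D) + of_bool (nxt D h \<in> tails D) + of_bool (nxt D (nxt D h) \<in> tails D)"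
    using legal_nodeD[OF assms] by (auto simp: node_def Int_insert_left)
  ultimately show ?thesis by simp
qed

lemma amplitude_cong:
  assumes "legal D" "\<And>h. h \<in> half_edges D \<Longrightarrow> s h = t h"
  shows "amplitude D s = amplitude D t"
proof -
  have "(\<Prod>e\<in>arrows D. arrow_factor s e) = (\<Prod>e\<in>arrows D. arrow_factor t e)"
    using legalD(4)[OF assms(1)] assms(2) by (intro prod.cong) (auto simp: arrow_factor_def)
  moreover have "(\<Prod>h\<in>inner D. vertex_factor D s h) = (\<Prod>h\<in>inner D. vertex_factor D t h)"
    using legal_nodeD[OF assms(1)] assms(2)
    by (intro prod.cong) (auto simp: vertex_factor_def half_edges_def)
  moreover have "map s (legs D) = map t (legs D)"
    using assms(2) by (auto simp: half_edges_def)
  ultimately show ?thesis unfolding amplitude_def by (simp only:)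
qed

section \<open>Invariance under isomorphism\<close>

lemma weight_iso:
  assumes "legal D" "legal E" "iso D E"
  shows "weight D = weight E"
proof -
  obtain f where bij: "bij_betw f (half_edges D) (half_edges E)"
    and inn: "f ` inner D = inner E" and lg: "map f (legs D) = legs E"
    and nx: "\<And>h. h \<in> inner D \<Longrightarrow> f (nxt D h) = nxt E (f h)"
    and ar: "map_prod f f ` arrows D = arrows E"
    using assms(3) by (auto simp: iso_def)
  define g where "g = inv_into (half_edges D) f"
  have gf: "g (f h) = h" if "h \<in> half_edges D" for h
    using bij that by (simp add: g_def bij_betw_inv_into_left)
  have fg: "f (g h) = h" if "h \<in> half_edges E" for h
    using bij that by (simp add: g_def bij_betw_inv_into_right)
  have fm: "f h \<in> half_edges E" if "h \<in> half_edges D" for h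
    using bij that by (auto simp: bij_betw_def)
  have gm: "g h \<in> half_edges D" if "h \<in> half_edges E" for h
    using bij_betw_inv_into[OF bij] that by (auto simp: g_def bij_betw_def)
  have inj: "inj_on f (half_edges D)" using bij by (simp add: bij_betw_def)
  have amp: "amplitude D (s \<circ> f) = amplitude E s" for s
  proof -
    have "inj_on (map_prod f f) (arrows D)"
      by (rule inj_on_subset[OF map_prod_inj_on[OF inj inj] legalD(4)[OF assms(1)]])
    then have "(\<Prod>e\<in>arrows E. arrow_factor s e) = (\<Prod>e\<in>arrows D. arrow_factor (s \<circ> f) e)"
      by (simp add: ar[symmetric] prod.reindex arrow_factor_def)
    moreover have "inj_on f (inner D)" using inj by (auto simp: half_edges_def inj_on_Un)
    then have "(\<Prod>h\<in>inner E. vertex_factor E s h) = (\<Prod>h\<in>inner D. vertex_factor D (s \<circ> f) h)"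
      using legal_nodeD(1)[OF assms(1)]
      by (simp add: inn[symmetric] prod.reindex vertex_factor_def nx)
    ultimately show ?thesis by (simp add: amplitude_def lg[symmetric])
  qed
  show ?thesis
    unfolding weight_def
  proof (rule sum.reindex_bij_witness[where
        i = "\<lambda>s. restrict (s \<circ> f) (half_edges D)" and j = "\<lambda>s. restrict (s \<circ> g) (half_edges E)"])
    fix s :: "nat \<Rightarrow> letter" assume s: "s \<in> half_edges D \<rightarrow>\<^sub>E UNIV"
    show "restrict (restrict (s \<circ> g) (half_edges E) \<circ> f) (half_edges D) = s"
      using s by (intro ext) (auto simp: restrict_def PiE_def extensional_def fm gf)
    have "amplitude E (restrict (s \<circ> g) (half_edges E)) = amplitude E (s \<circ> g)"
      by (rule amplitude_cong[OF assms(2)]) simp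
    also have "\<dots> = amplitude D (s \<circ> g \<circ> f)" by (rule amp[symmetric])
    also have "\<dots> = amplitude D s" by (rule amplitude_cong[OF assms(1)]) (simp add: gf)
    finally show "amplitude E (restrict (s \<circ> g) (half_edges E)) = amplitude D s" .
  next
    fix s :: "nat \<Rightarrow> letter" assume s: "s \<in> half_edges E \<rightarrow>\<^sub>E UNIV"
    show "restrict (restrict (s \<circ> f) (half_edges D) \<circ> g) (half_edges E) = s"
      using s by (intro ext) (auto simp: restrict_def PiE_def extensional_def gm fg)
  qed auto
qed

section \<open>The AS relation\<close>

lemma legal_reverse_at:
  assumes "legal D" "h \<in> inner D"
  shows "legal (reverse_at h D)"
proof -
  let ?E = "reverse_at h D"
  note n = legal_nodeD[OF assms]
  have [simp]: "inner ?E = inner D" "legs ?E = legs D" "arrows ?E = arrows D"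
    "half_edges ?E = half_edges D" "tails ?E = tails D" "heads ?E = heads D"
    by (auto simp: reverse_at_def half_edges_def tails_def heads_def)
  have on: "nxt ?E h = nxt D (nxt D h)" "nxt ?E (nxt D (nxt D h)) = nxt D h" "nxt ?E (nxt D h) = h"
    using n by (auto simp: reverse_at_def cyc_def)
  have off: "nxt ?E k = nxt D k" if "k \<in> inner D - node D h" for k
    using that by (auto simp: reverse_at_def cyc_def node_def)
  have split: "k \<in> inner D - node D h \<or> k = h \<or> k = nxt D h \<or> k = nxt D (nxt D h)"
    if "k \<in> inner D" for k using that by (auto simp: node_def)
  have steps: "nxt D k = nxt ?E k \<or> nxt D k = nxt ?E (nxt ?E k)"
    if "k \<in> inner D" for k
    using split[OF that] on off n by auto
  have node: "node ?E k = node D k" if "k \<in> inner D" for k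
    using split[OF that]
  proof (elim disjE)
    assume "k \<in> inner D - node D h"
    then show ?thesis
      using off nxt_outside_node[OF assms] by (simp add: node_def)
  qed (use on n in \<open>auto simp: node_def\<close>)
  have triv: "trivalent ?E"
    unfolding trivalent_def
  proof
    fix k assume "k \<in> inner ?E"
    then have k: "k \<in> inner D" by simp
    show "nxt ?E k \<in> inner ?E \<and> nxt ?E k \<noteq> k \<and> nxt ?E (nxt ?E (nxt ?E k)) = k"
      using split[OF k]
    proof (elim disjE)
      assume "k \<in> inner D - node D h"
      then show ?thesis
        using off nxt_outside_node[OF assms] legal_nodeD[OF assms(1) k] by simp
    qed (use on n assms(2) in auto)
  qed
  have "link D \<subseteq> (link ?E)\<^sup>*"
  proof (rule subrelI)
    fix a b assume ab: "(a, b) \<in> link D"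
    show "(a, b) \<in> (link ?E)\<^sup>*"
    proof (cases "(a, b) \<in> arrows D \<union> (arrows D)\<inverse>")
      case True
      then show ?thesis by (auto simp: link_def)
    next
      case False
      with ab have a: "a \<in> inner D" "b = nxt D a" by (auto simp: link_def)
      \<comment> \<open>going around the reversed vertex takes at most two steps\<close>
    have "b = nxt ?E a \<or> b = nxt ?E (nxt ?E a)" using steps[OF a(1)] a by auto
      moreover have "(k, nxt ?E k) \<in> link ?E" if "k \<in> inner D" for k
        using that by (auto simp: link_def)
      moreover have "nxt ?E a \<in> inner D" using triv a by (auto simp: trivalent_def)
      ultimately show ?thesis using a(1) by (metis r_into_rtrancl rtrancl_trans)
    qed
  qed
  then have "(link D)\<^sup>* \<subseteq> (link ?E)\<^sup>*" by (rule rtrancl_subset_rtrancl)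
  then have "connected_with_interval ?E"
    using assms(1) unfolding legal_def connected_with_interval_def by (simp; blast)
  moreover have "legally_directed ?E"
    using assms(1) node by (simp add: legal_def legally_directed_def)
  moreover have "edges_ok ?E" using assms(1) by (simp add: legal_def edges_ok_def)
  ultimately show ?thesis using assms(1) triv by (simp add: legal_def)
qed

lemma weight_reverse_at:
  assumes "legal D" "h \<in> inner D"
  shows "weight (reverse_at h D) = - weight D"
proof -
  let ?E = "reverse_at h D"
  note n = legal_nodeD[OF assms] and L = legal_reverse_at[OF assms]
  have [simp]: "inner ?E = inner D" "legs ?E = legs D" "arrows ?E = arrows D"
    "half_edges ?E = half_edges D"
    by (auto simp: reverse_at_def half_edges_def)
  have on: "nxt ?E h = nxt D (nxt D h)" "nxt ?E (nxt D (nxt D h)) = nxt D h" "nxt ?E (nxt D h) = h"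
    using n by (auto simp: reverse_at_def cyc_def)
  have off: "nxt ?E k = nxt D k" if "k \<in> inner D - node D h" for k
    using that by (auto simp: reverse_at_def cyc_def node_def)
  have node: "node ?E h = node D h" using on by (auto simp: node_def)
  have "(\<Prod>k\<in>inner ?E. vertex_factor ?E s k) = - (\<Prod>k\<in>inner D. vertex_factor D s k)" for s
  proof -
    have "(\<Prod>k\<in>inner D - node D h. vertex_factor ?E s k) =
        (\<Prod>k\<in>inner D - node D h. vertex_factor D s k)"
      using off nxt_outside_node[OF assms] by (intro prod.cong) (auto simp: vertex_factor_def)
    moreover have "vertex_factor ?E s h = - vertex_factor D s h"
      using on by (simp add: vertex_factor_def bracket3_swap[of "s h" "s (nxt D h)"])
    ultimately show ?thesis
      using prod_vertex_factor[OF assms n(7) legalD(1)[OF assms(1)], of s]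
        prod_vertex_factor[OF L, of h "inner D" s] assms n(7) node legalD(1)[OF assms(1)] by simp
  qed
  then have "amplitude ?E s = - amplitude D s" for s by (simp add: amplitude_def)
  then show ?thesis by (simp add: weight_def sum_negf)
qed

section \<open>The STU relation\<close>

lemma legal_swap_legs:
  assumes "legal T" "legs T = xs @ a # b # ys"
  shows "legal (T\<lparr>legs := xs @ b # a # ys\<rparr>)"
proof -
  let ?U = "T\<lparr>legs := xs @ b # a # ys\<rparr>"
  have s: "set (legs ?U) = set (legs T)" using assms(2) by auto
  have "half_edges ?U = half_edges T" "tails ?U = tails T" "heads ?U = heads T" "link ?U = link T"
    "\<And>h. node ?U h = node T h"
    using s by (auto simp: half_edges_def tails_def heads_def link_def node_def)
  moreover have "distinct (legs ?U)" using assms by (auto simp: legal_def)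
  ultimately show ?thesis
    using assms(1) s unfolding legal_def trivalent_def edges_ok_def legally_directed_def
      connected_with_interval_def by simp
qed

lemma legal_stu_S:
  assumes T: "legal T" and lg: "legs T = xs @ a # b # ys"
    and ab: "\<not> (a \<in> heads T \<and> b \<in> heads T)"
    and c: "c \<notin> half_edges T" and l: "l \<notin> half_edges T" and cl: "c \<noteq> l"
  shows "legal (stu_S T xs a b ys c l)"
proof -
  let ?S = "stu_S T xs a b ys c l"
  define e where "e = (if a \<in> tails T \<and> b \<in> tails T then (l, c) else (c, l))"
  have ar: "arrows ?S = insert e (arrows T)" by (simp add: stu_S_def e_def)
  have inn: "inner ?S = inner T \<union> {a, b, c}" and lgS: "legs ?S = xs @ l # ys"
    by (simp_all add: stu_S_def)
  have d: "distinct (legs T)" "inner T \<inter> set (legs T) = {}"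
    using T by (auto simp: legal_def)
  have abT: "a \<in> half_edges T" "b \<in> half_edges T" "a \<noteq> b" "a \<notin> inner T" "b \<notin> inner T"
    using d lg by (auto simp: half_edges_def)
  have neq: "a \<noteq> c" "b \<noteq> c" "a \<noteq> l" "b \<noteq> l" "c \<notin> inner T" "l \<notin> inner T" "l \<notin> set (legs T)"
    using abT c l by (auto simp: half_edges_def)
  have he: "half_edges ?S = insert c (insert l (half_edges T))"
    using lg by (auto simp: half_edges_def inn lgS)
  have on: "nxt ?S a = b" "nxt ?S b = c" "nxt ?S c = a"
    using abT neq by (auto simp: stu_S_def cyc_def)
  have off: "nxt ?S h = nxt T h" if "h \<in> inner T" for h
    using that abT neq by (auto simp: stu_S_def cyc_def)
  note nT = legal_nodeD[OF T]
  have triv: "trivalent ?S"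
    unfolding trivalent_def inn using on off nT abT neq by auto
  have eok: "edges_ok ?S"
    unfolding edges_ok_def
  proof (intro conjI ballI)
    show "arrows ?S \<subseteq> half_edges ?S \<times> half_edges ?S"
    proof -
      have "e \<in> half_edges ?S \<times> half_edges ?S" by (auto simp: he e_def)
      moreover have "half_edges T \<subseteq> half_edges ?S" by (auto simp: he)
      ultimately show ?thesis using legalD(4)[OF T] unfolding ar by blast
    qed
    show "case x of (u, v) \<Rightarrow> u \<noteq> v" if "x \<in> arrows ?S" for x
    proof -
      have "\<forall>(u, v)\<in>arrows T. u \<noteq> v" using T by (simp add: legal_def edges_ok_def)
      moreover have "x = e \<or> x \<in> arrows T" using that by (simp add: ar)
      ultimately show ?thesis using cl by (cases x) (auto simp: e_def split: if_splits)
    qed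
  next
    fix h assume h: "h \<in> half_edges ?S"
    have out: "f \<in> arrows T \<Longrightarrow> fst f \<noteq> c \<and> snd f \<noteq> c \<and> fst f \<noteq> l \<and> snd f \<noteq> l" for f
      using legalD(4)[OF T] c l by force
    show "\<exists>!f. f \<in> arrows ?S \<and> (h = fst f \<or> h = snd f)"
    proof (cases "h \<in> half_edges T")
      case True
      then have "h \<noteq> fst e" "h \<noteq> snd e" using c l by (auto simp: e_def)
      then show ?thesis using half_edge_arrow[OF T True] unfolding ar by blast
    next
      case False
      then have "h = c \<or> h = l" using h he by auto
      then show ?thesis using out unfolding ar
        by (intro ex1I[of _ e]) (auto simp: e_def)
    qed
  qed
  have tS: "tails ?S = insert (fst e) (tails T)" and hS: "heads ?S = insert (snd e) (heads T)"
    by (auto simp: tails_def heads_def ar)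
  have sub: "tails T \<subseteq> half_edges T" "heads T \<subseteq> half_edges T"
    using legalD(4)[OF T] by (auto simp: tails_def heads_def)
  have dir: "legally_directed ?S"
    unfolding legally_directed_def
  proof
    fix h assume "h \<in> inner ?S"
    then consider "h \<in> inner T" | "h = a \<or> h = b \<or> h = c" using inn by auto
    then show "card (node ?S h \<inter> tails ?S) = 2 \<and> card (node ?S h \<inter> heads ?S) = 1"
    proof cases
      case 1
      then have nd: "node ?S h = node T h" "node T h \<subseteq> inner T"
        using off nT[OF 1] by (auto simp: node_def)
      then have "fst e \<notin> node T h" "snd e \<notin> node T h" using neq by (auto simp: e_def)
      then have "node ?S h \<inter> tails ?S = node T h \<inter> tails T" "node ?S h \<inter> heads ?S = node T h \<inter> heads T"
        using nd tS hS by auto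
      then show ?thesis using T 1 by (auto simp: legal_def legally_directed_def)
    next
      case 2
      then have nd: "node ?S h = {a, b, c}" using on by (auto simp: node_def)
      have "c \<notin> tails T" "c \<notin> heads T" using sub c by auto
      then show ?thesis
        unfolding nd tS hS
        using ab heads_iff[OF T abT(1)] heads_iff[OF T abT(2)] abT neq cl
        by (cases "a \<in> tails T"; cases "b \<in> tails T") (auto simp: e_def Int_insert_left)
    qed
  qed
  have con: "connected_with_interval ?S"
    unfolding connected_with_interval_def
  proof
    fix h assume h: "h \<in> inner ?S"
    have lS: "l \<in> set (legs ?S)" by (simp add: lgS)
    have "(a, b) \<in> link ?S" "(b, c) \<in> link ?S" "(c, l) \<in> link ?S"
      using on by (auto simp: link_def inn ar e_def)
    then have abc: "(h, l) \<in> (link ?S)\<^sup>*" if "h = a \<or> h = b \<or> h = c" for h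
      using that by (meson r_into_rtrancl rtrancl_trans)
    show "\<exists>k\<in>set (legs ?S). (h, k) \<in> (link ?S)\<^sup>*"
    proof (cases "h \<in> inner T")
      case True
      then obtain k where k: "k \<in> set (legs T)" "(h, k) \<in> (link T)\<^sup>*"
        using T by (auto simp: legal_def connected_with_interval_def)
      have "link T \<subseteq> link ?S" using off by (auto simp: link_def inn ar)
      with k(2) have hk: "(h, k) \<in> (link ?S)\<^sup>*" using rtrancl_mono by blast
      show ?thesis
      proof (cases "k = a \<or> k = b")
        case True
        then have "(h, l) \<in> (link ?S)\<^sup>*" using hk abc[of k] by (meson rtrancl_trans)
        then show ?thesis using lS by blast
      next
        case False
        then have "k \<in> set (legs ?S)" using k(1) lg lgS by auto
        then show ?thesis using hk by blast
      qed
    next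
      case False
      then show ?thesis using h inn abc lS by blast
    qed
  qed
  have "distinct (legs ?S)" "inner ?S \<inter> set (legs ?S) = {}"
    using d lg neq cl abT c unfolding lgS inn half_edges_def by auto
  then show ?thesis
    unfolding legal_def using triv eok dir con legalD(1)[OF T] inn by auto
qed

text \<open>
  Two labels from the abelian ideal \<open>g\<^sup>*\<close> have bracket zero.
\<close>

lemma weight_swap_heads:
  assumes T: "legal T" and lg: "legs T = xs @ a # b # ys"
    and ab: "a \<in> heads T" "b \<in> heads T"
  shows "weight (T\<lparr>legs := xs @ b # a # ys\<rparr>) = weight T"
proof -
  let ?U = "T\<lparr>legs := xs @ b # a # ys\<rparr>"
  have he: "half_edges ?U = half_edges T" using lg by (auto simp: half_edges_def)
  have abT: "a \<in> half_edges T" "b \<in> half_edges T"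
    using lg by (auto simp: half_edges_def)
  have "amplitude ?U s = amplitude T s" for s
  proof (cases "(\<Prod>e\<in>arrows T. arrow_factor s e) = 0")
    case True
    then show ?thesis by (simp add: amplitude_def)
  next
    case False
    \<comment> \<open>no arrow has to be exempted, so take a pair that is not an arrow\<close>
    obtain e0 where "e0 \<notin> arrows T" "a \<noteq> fst e0" "a \<noteq> snd e0" "b \<noteq> fst e0" "b \<noteq> snd e0"
    proof -
      obtain k where "k \<notin> half_edges T"
        using legalD(2)[OF T] ex_new_if_finite infinite_UNIV_nat by blast
      then show ?thesis using that[of "(k, k)"] abT legalD(4)[OF T] by auto
    qed
    then have "\<not> is_tail (s a)" "\<not> is_tail (s b)"
      using is_tail_iff[OF T abT(1), of e0 s] is_tail_iff[OF T abT(2), of e0 s]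
        False ab heads_iff[OF T] abT by auto
    then have z: "bracket3 (s a) (s b) u = 0" for u
      using bracket3_is_tail[of "s a" "s b" u] by (cases "is_tail u") auto
    show ?thesis
      using word_value_commutator[of "map s xs" "s a" "s b" "map s ys" 0]
      by (simp add: amplitude_def lg z vertex_factor_def)
  qed
  then show ?thesis by (simp add: weight_def he)
qed

text \<open>
  For a fixed labelling of \<open>T\<close>, summing over the labels of the new edge of \<open>S\<close> yields the bracket of the
  labels of \<open>a\<close> and \<open>b\<close>, so the commutator formula applies labelling by labelling.
\<close>

lemma weight_stu:
  assumes T: "legal T" and lg: "legs T = xs @ a # b # ys"
    and ab: "\<not> (a \<in> heads T \<and> b \<in> heads T)"
    and c: "c \<notin> half_edges T" and l: "l \<notin> half_edges T" and cl: "c \<noteq> l"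
  shows "weight T - weight (T\<lparr>legs := xs @ b # a # ys\<rparr>) = weight (stu_S T xs a b ys c l)"
proof -
  let ?S = "stu_S T xs a b ys c l" and ?U = "T\<lparr>legs := xs @ b # a # ys\<rparr>"
  define e where "e = (if a \<in> tails T \<and> b \<in> tails T then (l, c) else (c, l))"
  note LS = legal_stu_S[OF assms]
  have ar: "arrows ?S = insert e (arrows T)" by (simp add: stu_S_def e_def)
  have inn: "inner ?S = inner T \<union> {a, b, c}" and lgS: "legs ?S = xs @ l # ys"
    by (simp_all add: stu_S_def)
  have d: "distinct (legs T)" "inner T \<inter> set (legs T) = {}"
    using T by (auto simp: legal_def)
  have abT: "a \<in> half_edges T" "b \<in> half_edges T" "a \<noteq> b" "a \<notin> inner T" "b \<notin> inner T"
    using d lg by (auto simp: half_edges_def)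
  have neq: "a \<noteq> c" "b \<noteq> c" "a \<noteq> l" "b \<noteq> l" "c \<notin> inner T" "l \<notin> inner T" "l \<notin> set (legs T)"
    using abT c l by (auto simp: half_edges_def)
  have heU: "half_edges ?U = half_edges T" using lg by (auto simp: half_edges_def)
  have he: "half_edges ?S = insert c (insert l (half_edges T))"
    using lg by (auto simp: half_edges_def inn lgS)
  have on: "nxt ?S a = b" "nxt ?S b = c" "nxt ?S c = a"
    using abT neq by (auto simp: stu_S_def cyc_def)
  have off: "nxt ?S h = nxt T h" if "h \<in> inner T" for h
    using that abT neq by (auto simp: stu_S_def cyc_def)
  note nT = legal_nodeD[OF T]
  have eT: "e \<notin> arrows T" using legalD(4)[OF T] c l by (auto simp: e_def)
  define P where "P s = (\<Prod>e\<in>arrows T. arrow_factor s e) * (\<Prod>h\<in>inner T. vertex_factor T s h)" for s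
  have amp: "amplitude ?S (s(l := v, c := u)) =
      P s * (joined ((s(l := v, c := u)) (fst e)) ((s(l := v, c := u)) (snd e)) *
        bracket3 (s a) (s b) u * word_value (map s xs @ v # map s ys) 0)" for s u v
  proof -
    let ?s = "s(l := v, c := u)"
    have old: "?s h = s h" if "h \<in> half_edges T" for h using that c l by auto
    have "(\<Prod>e\<in>arrows ?S. arrow_factor ?s e) = arrow_factor ?s e * (\<Prod>e\<in>arrows T. arrow_factor s e)"
    proof -
      have "(\<Prod>e\<in>arrows T. arrow_factor ?s e) = (\<Prod>e\<in>arrows T. arrow_factor s e)"
      proof (rule prod.cong)
        fix f assume "f \<in> arrows T"
        then have "fst f \<in> half_edges T" "snd f \<in> half_edges T" using legalD(4)[OF T] by auto
        then show "arrow_factor ?s f = arrow_factor s f" by (simp only: arrow_factor_def old)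
      qed simp
      then show ?thesis unfolding ar using eT legalD(3)[OF T] by simp
    qed
    moreover have "(\<Prod>h\<in>inner ?S. vertex_factor ?S ?s h) =
        bracket3 (s a) (s b) u * (\<Prod>h\<in>inner T. vertex_factor T s h)"
    proof -
      have nd: "node ?S a = {a, b, c}" using on by (simp add: node_def)
      have rest: "inner ?S - {a, b, c} = inner T" using inn abT neq by auto
      have "(\<Prod>h\<in>inner T. vertex_factor ?S ?s h) = (\<Prod>h\<in>inner T. vertex_factor T s h)"
        using off nT old by (intro prod.cong) (auto simp: vertex_factor_def half_edges_def)
      moreover have "vertex_factor ?S ?s a = bracket3 (s a) (s b) u"
        using on neq old abT cl by (simp add: vertex_factor_def)
      ultimately show ?thesis
        using prod_vertex_factor[OF LS, of a "inner ?S" ?s] nd rest inn legalD(1)[OF T] by simp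
    qed
    moreover have "map ?s (legs ?S) = map s xs @ v # map s ys"
      using lg old cl by (auto simp: lgS half_edges_def)
    ultimately show ?thesis by (simp add: amplitude_def P_def arrow_factor_def)
  qed
  have key: "amplitude T s - amplitude ?U s =
      (\<Sum>v\<in>UNIV. \<Sum>u\<in>UNIV. amplitude ?S (s(l := v, c := u)))" for s
  proof (cases "(\<Prod>e\<in>arrows T. arrow_factor s e) = 0")
    case True
    then show ?thesis by (simp add: amp P_def) (simp add: amplitude_def)
  next
    case False
    have ea: "a \<noteq> fst e" "a \<noteq> snd e" "b \<noteq> fst e" "b \<noteq> snd e" using neq by (auto simp: e_def)
    then have ty: "is_tail (s a) \<longleftrightarrow> a \<in> tails T" "is_tail (s b) \<longleftrightarrow> b \<in> tails T"
      using is_tail_iff[OF T abT(1), of e s] is_tail_iff[OF T abT(2), of e s] False eT by auto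
    have one: "a \<in> tails T \<or> b \<in> tails T" using ab heads_iff[OF T] abT by auto
    \<comment> \<open>the opposite direction of the new edge would contribute nothing, by the number of tails at its vertex\<close>
    have dir: "joined ((s(l := v, c := u)) (fst e)) ((s(l := v, c := u)) (snd e)) * bracket3 (s a) (s b) u
        = paired u v * bracket3 (s a) (s b) u" for u v
    proof (cases "bracket3 (s a) (s b) u = 0")
      case False
      from bracket3_is_tail[OF False]
      have "is_tail u \<longleftrightarrow> \<not> (a \<in> tails T \<and> b \<in> tails T)"
        using ty one by (cases "is_tail u") auto
      then show ?thesis
        using cl joined_is_tail[of u v] joined_is_tail[of v u] by (auto simp: e_def paired_def)
    qed simp
    have "amplitude T s - amplitude ?U s = P s *
        (word_value (map s xs @ s a # s b # map s ys) 0 - word_value (map s xs @ s b # s a # map s ys) 0)"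
      by (simp add: amplitude_def P_def lg vertex_factor_def right_diff_distrib)
    also have "\<dots> = (\<Sum>u\<in>UNIV. \<Sum>v\<in>UNIV. P s * (paired u v * bracket3 (s a) (s b) u *
        word_value (map s xs @ v # map s ys) 0))"
      by (simp add: word_value_commutator sum_distrib_left mult.assoc)
    also have "\<dots> = (\<Sum>u\<in>UNIV. \<Sum>v\<in>UNIV. amplitude ?S (s(l := v, c := u)))"
      by (simp only: amp dir)
    also have "\<dots> = (\<Sum>v\<in>UNIV. \<Sum>u\<in>UNIV. amplitude ?S (s(l := v, c := u)))"
      by (rule sum.swap)
    finally show ?thesis .
  qed
  have "weight ?S = (\<Sum>s\<in>half_edges T \<rightarrow>\<^sub>E UNIV. \<Sum>v\<in>UNIV. \<Sum>u\<in>UNIV. amplitude ?S (s(l := v, c := u)))"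
    using c l cl by (simp add: weight_def he sum_PiE_insert)
  then show ?thesis
    by (simp add: weight_def heU sum_subtractf[symmetric] key)
qed

section \<open>The IHX relation\<close>

text \<open>
  The contribution of everything away from an edge between \<open>p\<close> and \<open>q\<close> and its two end vertices. Both
  orders of the pair are removed, so that it does not change when the edge is redirected.
\<close>

definition remainder :: "pre_diagram \<Rightarrow> nat \<Rightarrow> nat \<Rightarrow> (nat \<Rightarrow> letter) \<Rightarrow> complex" where
  "remainder D p q s =
     (\<Prod>e\<in>arrows D - {(p, q), (q, p)}. arrow_factor s e) *
     (\<Prod>h\<in>inner D - (node D p \<union> node D q). vertex_factor D s h) * word_value (map s (legs D)) 0"

text \<open>
  Summing over the labels of \<open>p\<close> and \<open>q\<close> first contracts the two end vertices with the invariant form.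
  Since the arrow has one direction, only half of that form appears at first; the other half
  vanishes because each end vertex needs exactly two tails.
\<close>

lemma weight_split_edge:
  assumes D: "legal D" and pq: "p \<in> inner D" "q \<in> inner D" "q \<notin> node D p"
    and e: "(p, q) \<in> arrows D \<or> (q, p) \<in> arrows D"
  shows "weight D = (\<Sum>s\<in>half_edges D - {p, q} \<rightarrow>\<^sub>E UNIV. remainder D p q s *
     (\<Sum>u\<in>UNIV. \<Sum>v\<in>UNIV. paired u v *
       (bracket3 u (s (nxt D p)) (s (nxt D (nxt D p))) * bracket3 v (s (nxt D q)) (s (nxt D (nxt D q))))))"
proof -
  define e0 where "e0 = (if (p, q) \<in> arrows D then (p, q) else (q, p))"
  have e0: "e0 \<in> arrows D" using e by (auto simp: e0_def)
  have ne: "p \<noteq> q" using pq by (auto simp: node_def)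
  have pqh: "p \<in> half_edges D" "q \<in> half_edges D" using pq by (auto simp: half_edges_def)
  have unique: "f = e0" if "f \<in> arrows D" "p = fst f \<or> p = snd f \<or> q = fst f \<or> q = snd f" for f
  proof -
    have "p = fst e0 \<or> p = snd e0" "q = fst e0 \<or> q = snd e0" by (auto simp: e0_def)
    then show ?thesis
      using that e0 half_edge_arrow[OF D pqh(1)] half_edge_arrow[OF D pqh(2)] by blast
  qed
  have ar: "arrows D - {(p, q), (q, p)} = arrows D - {e0}"
  proof -
    have "(p, q) \<in> arrows D \<Longrightarrow> (p, q) = e0" "(q, p) \<in> arrows D \<Longrightarrow> (q, p) = e0"
      using unique[of "(p, q)"] unique[of "(q, p)"] by simp_all
    moreover have "e0 = (p, q) \<or> e0 = (q, p)" by (simp add: e0_def)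
    ultimately show ?thesis by blast
  qed
  note np = legal_nodeD[OF D pq(1)] and nq = legal_nodeD[OF D pq(2)]
  have disj: "node D p \<inter> node D q = {}"
    using np nq pq(3) unfolding node_def by (metis Int_emptyI insert_iff empty_iff)
  have other: "nxt D p \<noteq> q" "nxt D (nxt D p) \<noteq> q" "nxt D q \<noteq> p" "nxt D (nxt D q) \<noteq> p"
    using disj by (auto simp: node_def)
  have amp: "amplitude D (s(q := v, p := u)) = remainder D p q s *
      (arrow_factor (s(q := v, p := u)) e0 * (bracket3 u (s (nxt D p)) (s (nxt D (nxt D p))) *
        bracket3 v (s (nxt D q)) (s (nxt D (nxt D q)))))" for s u v
  proof -
    let ?s = "s(q := v, p := u)"
    have "(\<Prod>f\<in>arrows D - {e0}. arrow_factor ?s f) = (\<Prod>f\<in>arrows D - {e0}. arrow_factor s f)"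
      by (rule prod.cong) (use unique in \<open>auto simp: arrow_factor_def\<close>)
    then have "(\<Prod>f\<in>arrows D. arrow_factor ?s f) =
        arrow_factor ?s e0 * (\<Prod>f\<in>arrows D - {(p, q), (q, p)}. arrow_factor s f)"
      using prod.remove[OF legalD(3)[OF D] e0, of "arrow_factor ?s"] by (simp add: ar)
    moreover have "(\<Prod>h\<in>inner D. vertex_factor D ?s h) =
        vertex_factor D ?s p * (vertex_factor D ?s q *
        (\<Prod>h\<in>inner D - (node D p \<union> node D q). vertex_factor D s h))"
    proof -
      have "(\<Prod>h\<in>inner D - node D p - node D q. vertex_factor D ?s h) =
          (\<Prod>h\<in>inner D - node D p - node D q. vertex_factor D s h)"
      proof (rule prod.cong)
        fix h assume h: "h \<in> inner D - node D p - node D q"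
        then have h1: "nxt D h \<in> inner D - node D p" "nxt D h \<in> inner D - node D q"
          using nxt_outside_node[OF D pq(1)] nxt_outside_node[OF D pq(2)] by blast+
        then have "nxt D (nxt D h) \<in> inner D - node D p" "nxt D (nxt D h) \<in> inner D - node D q"
          using nxt_outside_node[OF D pq(1)] nxt_outside_node[OF D pq(2)] by blast+
        with h h1 show "vertex_factor D ?s h = vertex_factor D s h"
          by (auto simp: vertex_factor_def node_def)
      qed simp
      moreover have sets: "node D q \<subseteq> inner D - node D p"
        "inner D - node D p - node D q = inner D - (node D p \<union> node D q)"
        using nq(7) disj by blast+
      ultimately show ?thesis
        using prod_vertex_factor[OF D pq(1) np(7) legalD(1)[OF D], of ?s]
          prod_vertex_factor[OF D pq(2), of "inner D - node D p" ?s] sets legalD(1)[OF D]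
        by simp
    qed
    moreover have "vertex_factor D ?s p = bracket3 u (s (nxt D p)) (s (nxt D (nxt D p)))"
      "vertex_factor D ?s q = bracket3 v (s (nxt D q)) (s (nxt D (nxt D q)))"
      using np nq other ne by (auto simp: vertex_factor_def)
    moreover have "map ?s (legs D) = map s (legs D)"
      using D pq by (auto simp: legal_def)
    ultimately show ?thesis unfolding amplitude_def remainder_def by (simp only: ac_simps)
  qed
  have dir: "amplitude D (s(q := v, p := u)) = remainder D p q s *
      (paired u v * (bracket3 u (s (nxt D p)) (s (nxt D (nxt D p))) *
        bracket3 v (s (nxt D q)) (s (nxt D (nxt D q)))))" for s u v
  proof (cases "remainder D p q s = 0 \<or> bracket3 u (s (nxt D p)) (s (nxt D (nxt D p))) = 0")
    case True
    then show ?thesis by (auto simp: amp)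
  next
    case False
    then have A: "(\<Prod>e\<in>arrows D - {e0}. arrow_factor s e) \<noteq> 0" by (auto simp: remainder_def ar)
    have "is_tail (s h) \<longleftrightarrow> h \<in> tails D" if "h \<in> half_edges D" "h \<noteq> p" "h \<noteq> q" for h
      using is_tail_iff[OF D that(1) _ _ A] that by (auto simp: e0_def)
    then have "is_tail (s (nxt D p)) \<longleftrightarrow> nxt D p \<in> tails D"
      "is_tail (s (nxt D (nxt D p))) \<longleftrightarrow> nxt D (nxt D p) \<in> tails D"
      using np other by (auto simp: half_edges_def)
    then have "is_tail u \<longleftrightarrow> p \<in> tails D"
      using False bracket3_is_tail[of u "s (nxt D p)" "s (nxt D (nxt D p))"] card_node_tails[OF D pq(1)]
      by (cases "is_tail u"; cases "p \<in> tails D") auto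
    moreover have "p \<in> tails D \<longleftrightarrow> e0 = (p, q)"
      using e0 snd_not_tail[OF D] ne by (force simp: e0_def tails_def)
    ultimately show ?thesis
      using joined_is_tail[of u v] joined_is_tail[of v u] ne
      by (auto simp: amp arrow_factor_def paired_def e0_def split: if_splits)
  qed
  have he: "half_edges D = insert p (insert q (half_edges D - {p, q}))" using pqh by auto
  have "weight D = (\<Sum>s\<in>insert p (insert q (half_edges D - {p, q})) \<rightarrow>\<^sub>E UNIV. amplitude D s)"
    unfolding weight_def using he by simp
  also have "\<dots> = (\<Sum>s\<in>half_edges D - {p, q} \<rightarrow>\<^sub>E UNIV. \<Sum>v\<in>UNIV. \<Sum>u\<in>UNIV. amplitude D (s(q := v, p := u)))"
    using ne by (simp add: sum_PiE_insert)
  also have "\<dots> = (\<Sum>s\<in>half_edges D - {p, q} \<rightarrow>\<^sub>E UNIV. \<Sum>u\<in>UNIV. \<Sum>v\<in>UNIV. amplitude D (s(q := v, p := u)))"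
    by (rule sum.cong[OF refl sum.swap])
  finally show ?thesis by (simp add: dir sum_distrib_left)
qed

text \<open>
  The terms of an IHX relation differ only in how the four outer half-edges are distributed on the two
  vertices; the remainder is that of the diagram \<open>D\<close> for all of them.
\<close>

lemma weight_rewire:
  assumes D: "legal D" and pq: "p \<in> inner D" "q \<in> inner D" "q \<notin> node D p" "(p, q) \<in> arrows D"
    and E: "E \<in> rewire D p q (cyc p x y (cyc q z w (nxt D)))"
    and xyzw: "{x, y, z, w} = {nxt D p, nxt D (nxt D p), nxt D q, nxt D (nxt D q)}"
      "distinct [x, y, z, w]"
  shows "weight E = (\<Sum>s\<in>half_edges D - {p, q} \<rightarrow>\<^sub>E UNIV. remainder D p q s *
     (\<Sum>u\<in>UNIV. \<Sum>v\<in>UNIV. paired u v * (bracket3 u (s x) (s y) * bracket3 v (s z) (s w))))"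
proof -
  let ?f = "cyc p x y (cyc q z w (nxt D))"
  obtain e where LE: "legal E" and e: "e = (p, q) \<or> e = (q, p)"
    and Edef: "E = D\<lparr>nxt := ?f, arrows := insert e (arrows D - {(p, q)})\<rparr>"
    using E unfolding rewire_def by blast
  have ne: "p \<noteq> q" using pq by (auto simp: node_def)
  note np = legal_nodeD[OF D pq(1)] and nq = legal_nodeD[OF D pq(2)]
  have disj: "node D p \<inter> node D q = {}"
    using np nq pq(3) unfolding node_def by (metis Int_emptyI insert_iff empty_iff)
  have "p \<notin> {x, y, z, w}" "q \<notin> {x, y, z, w}"
    unfolding xyzw(1) using disj np nq by (auto simp: node_def)
  then have on: "nxt E p = x" "nxt E x = y" "nxt E q = z" "nxt E z = w"
    using ne xyzw(2) by (auto simp: Edef cyc_def)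
  have nodes: "node E p \<union> node E q = node D p \<union> node D q"
    using on xyzw(1) by (auto simp: node_def)
  have ndE: "node E p = {p, x, y}" "q \<notin> node E p"
    using on ne \<open>q \<notin> {x, y, z, w}\<close> by (auto simp: node_def)
  have "nxt E h = nxt D h" if "h \<in> inner D - (node D p \<union> node D q)" for h
    using that xyzw(1) unfolding Edef by (auto simp: cyc_def node_def)
  moreover have "nxt D h \<in> inner D - (node D p \<union> node D q)" if "h \<in> inner D - (node D p \<union> node D q)" for h
    using that nxt_outside_node[OF D pq(1)] nxt_outside_node[OF D pq(2)] by blast
  ultimately have vf: "(\<Prod>h\<in>inner D - (node D p \<union> node D q). vertex_factor E s h) =
      (\<Prod>h\<in>inner D - (node D p \<union> node D q). vertex_factor D s h)" for s
    by (intro prod.cong) (simp_all add: vertex_factor_def)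
  have ar: "arrows E - {(p, q), (q, p)} = arrows D - {(p, q), (q, p)}"
    using e by (auto simp: Edef)
  have rem: "remainder E p q s = remainder D p q s" for s
    using vf by (simp add: remainder_def ar nodes) (simp add: Edef)
  have he: "half_edges E = half_edges D" by (auto simp: Edef half_edges_def)
  have "p \<in> inner E" "q \<in> inner E" "(p, q) \<in> arrows E \<or> (q, p) \<in> arrows E"
    using pq e by (auto simp: Edef)
  from weight_split_edge[OF LE this(1,2) ndE(2) this(3)] show ?thesis
    by (simp add: rem he on)
qed

lemma weight_ihx:
  assumes D: "legal D" and pq: "p \<in> inner D" "q \<in> inner D" "(p, q) \<in> arrows D" "q \<notin> node D p"
    and n: "ne = nxt D p" "nw = nxt D ne" "sw = nxt D q" "se = nxt D sw"
    and H: "H \<in> rewire D p q (cyc p nw sw (cyc q se ne (nxt D)))"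
    and K: "K \<in> rewire D p q (cyc p ne sw (cyc q se nw (nxt D)))"
  shows "weight D - weight H + weight K = 0"
proof -
  note np = legal_nodeD[OF D pq(1)] and nq = legal_nodeD[OF D pq(2)]
  have disj: "node D p \<inter> node D q = {}"
    using np nq pq(4) unfolding node_def by (metis Int_emptyI insert_iff empty_iff)
  have dist: "distinct [ne, nw, sw, se]"
    using disj np nq by (auto simp: n node_def)
  note rw = weight_rewire[OF D pq(1,2,4,3)]
  define J where "J a b c d = (\<Sum>u\<in>UNIV. \<Sum>v\<in>UNIV. paired u v * (bracket3 u a b * bracket3 v c d))"
    for a b c d
  let ?S = "\<lambda>f. \<Sum>s\<in>half_edges D - {p, q} \<rightarrow>\<^sub>E UNIV. remainder D p q s * f s"
  have "weight D = ?S (\<lambda>s. J (s ne) (s nw) (s sw) (s se))"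
    using weight_split_edge[OF D pq(1,2,4) disjI1[OF pq(3)]] by (simp add: n J_def)
  moreover have "weight H = ?S (\<lambda>s. J (s nw) (s sw) (s se) (s ne))"
    unfolding J_def by (rule rw[OF H]) (use dist in \<open>auto simp: n\<close>)
  moreover have "weight K = ?S (\<lambda>s. J (s ne) (s sw) (s se) (s nw))"
    unfolding J_def by (rule rw[OF K]) (use dist in \<open>auto simp: n\<close>)
  ultimately have "weight D - weight H + weight K = ?S (\<lambda>s. J (s ne) (s nw) (s sw) (s se) -
      J (s nw) (s sw) (s se) (s ne) + J (s ne) (s sw) (s se) (s nw))"
    by (simp add: sum_subtractf sum.distrib right_diff_distrib distrib_left)
  then show ?thesis unfolding J_def jacobi by simp
qed

section \<open>The induced functional on the quotient\<close>

lift_definition diagram_weight :: "diagram \<Rightarrow> complex" is weight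
  using weight_iso by blast

lemma diagram_weight_abs: "legal D \<Longrightarrow> diagram_weight (abs_diagram D) = weight D"
  by (rule diagram_weight.abs_eq) (simp add: iso_refl)

definition extend :: "free_space \<Rightarrow> complex" where
  "extend f = (\<Sum>d\<in>Poly_Mapping.keys f. poly_mapping.lookup f d * diagram_weight d)"

lemma extend_superset:
  assumes "finite A" "Poly_Mapping.keys f \<subseteq> A"
  shows "extend f = (\<Sum>d\<in>A. poly_mapping.lookup f d * diagram_weight d)"
  unfolding extend_def by (rule sum.mono_neutral_left) (use assms in \<open>auto simp: in_keys_iff\<close>)

lemma extend_add: "extend (f + g) = extend f + extend g"
proof -
  let ?A = "Poly_Mapping.keys f \<union> Poly_Mapping.keys g"
  have "Poly_Mapping.keys (f + g) \<subseteq> ?A" by (rule keys_add)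
  then show ?thesis
    using extend_superset[of ?A f] extend_superset[of ?A g] extend_superset[of ?A "f + g"]
    by (simp add: lookup_add distrib_right sum.distrib)
qed

lemma extend_scale: "extend (scale_free c f) = c * extend f"
proof -
  have "Poly_Mapping.keys (scale_free c f) \<subseteq> Poly_Mapping.keys f" by (auto simp: in_keys_iff)
  from extend_superset[OF finite_keys this] show ?thesis
    by (simp add: extend_def sum_distrib_left mult.assoc)
qed

lemma extend_diff: "extend (f - g) = extend f - extend g"
  using extend_add[of "f - g" g] by simp

lemma extend_single: "extend (Poly_Mapping.single d 1) = diagram_weight d"
  by (simp add: extend_def)

lemma extend_diag: "legal D \<Longrightarrow> extend (diag D) = weight D"
  by (simp add: diag_def extend_single diagram_weight_abs)

lemma extend_relators:
  assumes "f \<in> AS_relators \<union> STU_relators \<union> IHX_relators"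
  shows "extend f = 0"
  using assms
proof (elim UnE)
  assume "f \<in> AS_relators"
  then show ?thesis
    by (auto simp: AS_relators_def extend_add extend_diag legal_reverse_at weight_reverse_at)
next
  assume "f \<in> STU_relators"
  then show ?thesis
    using weight_stu by (auto simp: STU_relators_def extend_diff extend_diag legal_swap_legs legal_stu_S
        weight_swap_heads)
next
  assume "f \<in> IHX_relators"
  then obtain D H K p q ne nw sw se where f: "f = diag D - diag H + diag K"
    and h: "legal D" "p \<in> inner D" "q \<in> inner D" "(p, q) \<in> arrows D" "q \<notin> node D p"
     "ne = nxt D p" "nw = nxt D ne" "sw = nxt D q" "se = nxt D sw"
     "H \<in> rewire D p q (cyc p nw sw (cyc q se ne (nxt D)))"
     "K \<in> rewire D p q (cyc p ne sw (cyc q se nw (nxt D)))"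
    unfolding IHX_relators_def by blast
  then have "legal H" "legal K" by (auto simp: rewire_def)
  then show ?thesis
    using weight_ihx[OF h] h(1) by (simp add: f extend_add extend_diff extend_diag)
qed

lemma extend_relations:
  assumes "f \<in> relations"
  shows "extend f = 0"
proof -
  have "free.subspace {f. extend f = 0}"
    by (rule free.subspaceI) (simp_all add: extend_add extend_scale, simp add: extend_def)
  then have "relations \<subseteq> {f. extend f = 0}"
    unfolding relations_def using extend_relators by (intro free.span_minimal) auto
  then show ?thesis using assms by blast
qed

lemma diagram_class_nonzero:
  assumes "diagram_weight d \<noteq> 0"
  shows "diagram_class d \<noteq> 0"
proof
  assume "diagram_class d = 0"
  then have "Poly_Mapping.single d 1 - 0 \<in> relations"
    unfolding diagram_class_def zero_arrow_space_def
    by (simp only: arrow_space.abs_eq_iff)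
  then show False using extend_relations[of "Poly_Mapping.single d 1"] assms
    by (simp add: extend_single)
qed

section \<open>The weight of a wheel\<close>

text \<open>
  The only labelling that contributes to the weight of a wheel.
\<close>

definition wheel_labelling :: "bool \<Rightarrow> nat \<Rightarrow> letter" where
  "wheel_labelling fwd h =
     (if h mod 4 = 0 then X else if h mod 4 = 3 then X' else if (h mod 4 = 1) = fwd then Y else Y')"

lemma half_edges_wheel:
  "h \<in> half_edges (pre_wheel fwd m) \<longleftrightarrow> (\<exists>i<m. h = 4 * i \<or> h = 4 * i + 1 \<or> h = 4 * i + 2 \<or> h = 4 * i + 3)"
proof -
  have three: "(\<exists>j<3. P j) \<longleftrightarrow> P 0 \<or> P 1 \<or> P 2" for P :: "nat \<Rightarrow> bool"
    by (auto simp: eval_nat_numeral less_Suc_eq)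
  have "h \<in> inner (pre_wheel fwd m) \<longleftrightarrow> (\<exists>i<m. \<exists>j<3. h = 4 * i + j)" by (auto simp: inner_wheel)
  also have "\<dots> \<longleftrightarrow> (\<exists>i<m. h = 4 * i \<or> h = 4 * i + 1 \<or> h = 4 * i + 2)"
    by (simp only: three add_0_right)
  finally show ?thesis by (auto simp: half_edges_def legs_wheel)
qed

text \<open>
  The head on the cycle at each vertex must carry \<open>Y'\<close>, as \<open>X'\<close> does not occur in the form. Its arrow then has \<open>Y\<close> at the
  tail, and this leaves \<open>X\<close> for the leg.
\<close>

lemma amplitude_wheel_nonzero_imp:
  assumes "amplitude (pre_wheel fwd m) s \<noteq> 0" "h \<in> half_edges (pre_wheel fwd m)"
  shows "s h = wheel_labelling fwd h"
proof -
  let ?D = "pre_wheel fwd m"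
  have A: "arrow_factor s e \<noteq> 0" if "e \<in> arrows ?D" for e
    using assms(1) that legalD(3)[OF legal_wheel] by (auto simp: amplitude_def)
  have V: "vertex_factor ?D s h \<noteq> 0" if "h \<in> inner ?D" for h
    using assms(1) that legalD(1)[OF legal_wheel] by (auto simp: amplitude_def)
  have leg: "joined (s (4 * i)) (s (4 * i + 3)) \<noteq> 0" if "i < m" for i
    using A[of "(4 * i, 4 * i + 3)"] that by (auto simp: arrows_wheel arrow_factor_def)
  have vert: "bracket3 (s (4 * i)) (s (4 * i + 1)) (s (4 * i + 2)) \<noteq> 0" if "i < m" for i
  proof -
    have "4 * i + 0 \<in> inner ?D" using that unfolding inner_wheel by force
    moreover have "(4 * i + 1) mod 4 \<noteq> 2" "(4 * i) mod 4 \<noteq> 2" by presburger+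
    ultimately show ?thesis using V[of "4 * i"] by (simp add: vertex_factor_def nxt_wheel)
  qed
  \<comment> \<open>the offsets of the outgoing and the incoming half-edge on the cycle\<close>
  define out inc where "out = (if fwd then 1 else 2 :: nat)" and "inc = (if fwd then 2 else 1 :: nat)"
  have cycle: "\<exists>k<m. joined (s (4 * i + out)) (s (4 * k + inc)) \<noteq> 0"
    "\<exists>k<m. joined (s (4 * k + out)) (s (4 * i + inc)) \<noteq> 0" if i: "i < m" for i
  proof -
    obtain k where k: "k < m" "Suc k mod m = i" using pred_mod[OF i] by blast
    define after where "after i = Suc i mod m" for i
    have j: "after i < m" using i by (auto simp: after_def)
    have e: "joined (s (4 * (if fwd then i else after i) + out)) (s (4 * (if fwd then after i else i) + inc)) \<noteq> 0"
      if "i < m" for i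
      using A[of "(4 * (if fwd then i else after i) + out, 4 * (if fwd then after i else i) + inc)"] that
      by (cases fwd) (auto simp: arrows_wheel arrow_factor_def out_def inc_def after_def)
    have k': "after k = i" using k(2) by (simp add: after_def)
    show "\<exists>k<m. joined (s (4 * i + out)) (s (4 * k + inc)) \<noteq> 0"
      using e[OF i] e[OF k(1)] j k(1) k' by (cases fwd) (simp; blast)+
    show "\<exists>k<m. joined (s (4 * k + out)) (s (4 * i + inc)) \<noteq> 0"
      using e[OF i] e[OF k(1)] j k(1) k' by (cases fwd) (simp; blast)+
  qed
  have inc: "s (4 * i + inc) = Y'" if i: "i < m" for i
  proof -
    have "\<not> is_tail (s (4 * i + inc))" using cycle(2)[OF i] joined_is_tail by blast
    then show ?thesis using vert[OF i]
      by (cases "s (4 * i + inc)") (auto simp: is_tail_def bracket3_def inc_def split: if_splits)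
  qed
  have out: "s (4 * i + out) = Y" if i: "i < m" for i
    using cycle(1)[OF i] inc by (auto simp: joined_def)
  have spoke: "s (4 * i) = X" if i: "i < m" for i
    using vert[OF i] inc[OF i] out[OF i] 
    by (auto simp: bracket3_def inc_def out_def split: if_splits)
  have leg': "s (4 * i + 3) = X'" if i: "i < m" for i
    using leg[OF i] spoke[OF i] by (auto simp: joined_def)
  obtain i where i: "i < m" "h = 4 * i \<or> h = 4 * i + 1 \<or> h = 4 * i + 2 \<or> h = 4 * i + 3"
    using assms(2) half_edges_wheel by blast
  have "(4 * i) mod 4 = 0" "(4 * i + 1) mod 4 = 1" "(4 * i + 2) mod 4 = 2" "(4 * i + 3) mod 4 = 3"
    by presburger+
  with i(2) inc[OF i(1)] out[OF i(1)] spoke[OF i(1)] leg'[OF i(1)] show ?thesis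
    by (elim disjE; cases fwd; simp only: wheel_labelling_def inc_def out_def) simp_all
qed

lemma amplitude_wheel_labelling: "amplitude (pre_wheel fwd m) (wheel_labelling fwd) \<noteq> 0"
proof -
  let ?D = "pre_wheel fwd m" and ?s = "wheel_labelling fwd"
  have md: "(4 * i) mod 4 = 0" "(4 * i + 1) mod 4 = 1" "(4 * i + 2) mod 4 = 2" "(4 * i + 3) mod 4 = 3"
    for i :: nat by presburger+
  have s: "?s (4 * i) = X" "?s (4 * i + 1) = (if fwd then Y else Y')"
    "?s (4 * i + 2) = (if fwd then Y' else Y)" "?s (4 * i + 3) = X'" for i
    unfolding wheel_labelling_def md by auto
  have "arrow_factor ?s e \<noteq> 0" if "e \<in> arrows ?D" for e
    using that s by (cases e) (auto simp: arrows_wheel arrow_factor_def joined_def split: if_splits)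
  moreover have "vertex_factor ?D ?s h \<noteq> 0" if "h \<in> inner ?D" for h
  proof -
    obtain i j where "j < 3" "h = 4 * i + j" using \<open>h \<in> inner ?D\<close> unfolding inner_wheel by blast
    then have h: "h = 4 * i \<or> h = 4 * i + 1 \<or> h = 4 * i + 2" by auto
    have n: "nxt ?D (4 * i) = 4 * i + 1" "nxt ?D (4 * i + 1) = 4 * i + 2" "nxt ?D (4 * i + 2) = 4 * i"
      by (simp_all add: nxt_wheel) presburger+
    from h show ?thesis
      by (elim disjE; simp only: vertex_factor_def n s) (auto simp: bracket3_def)
  qed
  moreover have "word_value (map ?s (legs ?D)) 0 = 1"
  proof -
    have "map ?s (legs ?D) = map (\<lambda>_. X') [0..<m]" unfolding legs_wheel using s by simp
    moreover have "word_value (map (\<lambda>_. X') xs) n = 1" for xs :: "nat list" and n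
      by (induction xs) auto
    ultimately show ?thesis by simp
  qed
  ultimately show ?thesis
    using legalD[OF legal_wheel] by (auto simp: amplitude_def prod_zero_iff)
qed

lemma weight_wheel: "weight (pre_wheel fwd m) \<noteq> 0"
proof -
  let ?D = "pre_wheel fwd m" and ?s = "restrict (wheel_labelling fwd) (half_edges (pre_wheel fwd m))"
  have "amplitude ?D s = 0" if "s \<in> (half_edges ?D \<rightarrow>\<^sub>E UNIV) - {?s}" for s
  proof (rule ccontr)
    assume "amplitude ?D s \<noteq> 0"
    then have "s = ?s"
      using amplitude_wheel_nonzero_imp that by (intro ext) (auto simp: PiE_def extensional_def)
    then show False using that by simp
  qed
  moreover have fin: "finite (half_edges ?D \<rightarrow>\<^sub>E (UNIV :: letter set))"
    by (simp add: finite_PiE legalD(2)[OF legal_wheel])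
  ultimately have "weight ?D = amplitude ?D ?s"
    unfolding weight_def
    using sum.mono_neutral_right[of "half_edges ?D \<rightarrow>\<^sub>E UNIV" "{?s}" "amplitude ?D"]
      fin by auto
  also have "\<dots> = amplitude ?D (wheel_labelling fwd)"
    by (rule amplitude_cong[OF legal_wheel]) simp
  finally show ?thesis using amplitude_wheel_labelling by simp
qed

theorem proposition3p5:
  fixes m :: nat and fwd :: bool
  assumes "even m" and "m \<ge> 2"
  shows "diagram_class (wheel fwd m) \<noteq> 0"
  by (rule diagram_class_nonzero) (simp add: wheel.abs_eq diagram_weight_abs legal_wheel weight_wheel)

end
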